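(* Let $u$ be a real-valued function which is semiconvex on a (convex) neighborhood of a point $x\in\mathbb{R}^n$, and suppose that $(p,A)\in\mathbb{R}^n\times\mathcal{S}(n)$ is an upper contact jet for $u$ at $x$. Then: (1) (differentiability at upper contact points) $u$ is differentiable at $x$ and $p=Du(x)$ is unique (every upper contact jet for $u$ at $x$ has first component $Du(x)$). Furthermore, for every set $E$ of full Lebesgue measure in a neighborhood of $x$ there exist a sequence $\{x_j\}_{j\in\mathbb{N}}\subset E\cap \mathrm{Diff}^2 u$ with $x_j\to x$ as $j\to\infty$, and a matrix $\bar A\in\mathcal{S}(n)$, such that: (2) (partial continuity of first derivatives) $Du(x_j)\to Du(x)=p$; (3) (partial upper semicontinuity of second derivatives) $D^2u(x_j)\to\bar A\leq A$.
   Context: $\mathcal{S}(n)$ is the space of real symmetric $n\times n$ matrices with the Loewner order ($A\geq B$ iff $A-B$ is positive semidefinite). A function $u:C\to\mathbb{R}$ on a convex set $C\subset\mathbb{R}^n$ is $\lambda$-semiconvex ($\lambda\ge 0$) if $u+\frac{\lambda}{2}|\cdot|^2$ is convex on $C$; it is semiconvex if it is $\lambda$-semiconvex for some $\lambda\geq 0$. A pair $(p,A)\in\mathbb{R}^n\times\mathcal{S}(n)$ is an upper contact jet for $u$ at $x$ if $u(y)\leq u(x)+\langle p,y-x\rangle+\frac12\langle A(y-x),y-x\rangle$ for all $y$ near $x$ in the domain of $u$. $u$ is twice differentiable (in the Peano sense) at $z$ if there exist $q\in\mathbb{R}^n$, $B\in\mathcal{S}(n)$ with $u(y)=u(z)+\langle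 q,y-z\rangle+\frac12\langle B(y-z),y-z\rangle+o(|y-z|^2)$ as $y\to z$; then $q=Du(z)$, and one writes $D^2u(z)=B$ (these are unique). $\mathrm{Diff}^2u$ is the set of points where $u$ is twice differentiable in this sense. *)

theory Defs
  imports "HOL-Analysis.Analysis" "HOL-Library.Landau_Symbols"
begin

definition sym_matrices :: "(real^'n^'n) set" where
  "sym_matrices = {A. transpose A = A}"

definition pos_semidef :: "real^'n^'n \<Rightarrow> bool" where
  "pos_semidef A \<longleftrightarrow> A \<in> sym_matrices \<and> (\<forall>v. 0 \<le> (A *v v) \<bullet> v)"

definition loewner_le :: "real^'n^'n \<Rightarrow> real^'n^'n \<Rightarrow> bool" where
  "loewner_le A B \<longleftrightarrow> pos_semidef (B - A)"

text \<open>The library predicate \<open>convex_on\<close> includes the convexity of the set \<open>C\<close>.\<close>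

definition lambda_semiconvex_on :: "real \<Rightarrow> (real^'n) set \<Rightarrow> (real^'n \<Rightarrow> real) \<Rightarrow> bool" where
  "lambda_semiconvex_on lam C u \<longleftrightarrow>
     lam \<ge> 0 \<and> convex_on C (\<lambda>y. u y + lam / 2 * (norm y)\<^sup>2)"

definition semiconvex_on :: "(real^'n) set \<Rightarrow> (real^'n \<Rightarrow> real) \<Rightarrow> bool" where
  "semiconvex_on C u \<longleftrightarrow> (\<exists>lam. lambda_semiconvex_on lam C u)"

text \<open>A real-valued function with domain \<open>X\<close> is represented by a total function \<open>u\<close>
  whose values outside \<open>X\<close> are irrelevant.\<close>

definition upper_contact_jet ::
  "(real^'n) set \<Rightarrow> (real^'n \<Rightarrow> real) \<Rightarrow> real^'n \<Rightarrow> real^'n \<Rightarrow> real^'n^'n \<Rightarrow> bool" where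
  "upper_contact_jet X u x p A \<longleftrightarrow> A \<in> sym_matrices \<and>
     (\<forall>\<^sub>F y in nhds x. y \<in> X \<longrightarrow>
        u y \<le> u x + p \<bullet> (y - x) + 1/2 * ((A *v (y - x)) \<bullet> (y - x)))"

definition has_peano_expansion ::
  "(real^'n \<Rightarrow> real) \<Rightarrow> real^'n \<Rightarrow> real^'n \<Rightarrow> real^'n^'n \<Rightarrow> bool" where
  "has_peano_expansion u z q B \<longleftrightarrow> B \<in> sym_matrices \<and>
     (\<lambda>y. u y - (u z + q \<bullet> (y - z) + 1/2 * ((B *v (y - z)) \<bullet> (y - z))))
       \<in> o[at z](\<lambda>y. (norm (y - z))\<^sup>2)"

text \<open>Second order differentiability is considered at interior points of the domain \<open>X\<close>,
  so that the expansion as \<open>y \<rightarrow> z\<close> only involves values of \<open>u\<close> on \<open>X\<close>.\<close>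

definition Diff2 :: "(real^'n) set \<Rightarrow> (real^'n \<Rightarrow> real) \<Rightarrow> (real^'n) set" where
  "Diff2 X u = {z \<in> interior X. \<exists>q B. has_peano_expansion u z q B}"

definition Du :: "(real^'n \<Rightarrow> real) \<Rightarrow> real^'n \<Rightarrow> real^'n" where
  "Du u z = (THE q. GDERIV u z :> q)"

definition D2u :: "(real^'n \<Rightarrow> real) \<Rightarrow> real^'n \<Rightarrow> real^'n^'n" where
  "D2u u z = (THE B. \<exists>q. has_peano_expansion u z q B)"

lemma Du_eq:
  assumes "GDERIV u z :> q"
  shows "Du u z = q"
  unfolding Du_def
proof (rule the_equality)
  fix r assume "GDERIV u z :> r"
  with assms have "(\<lambda>h. h \<bullet> r) = (\<lambda>h. h \<bullet> q)"
    unfolding gderiv_def using has_derivative_unique by blast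
  then show "r = q" by (simp add: fun_eq_iff vector_eq_ldot)
qed fact

lemma has_peano_expansion_GDERIV:
  fixes u :: "real^'n \<Rightarrow> real"
  assumes "has_peano_expansion u z q B"
  shows "GDERIV u z :> q"
proof -
  let ?Q = "\<lambda>y. 1/2 * ((B *v (y - z)) \<bullet> (y - z))"
  let ?r = "\<lambda>y. u y - (u z + q \<bullet> (y - z) + ?Q y)"
  have "?r \<in> o[at z](\<lambda>y. (norm (y - z))\<^sup>2)"
    using assms by (simp add: has_peano_expansion_def)
  then have r: "((\<lambda>y. ?r y / (norm (y - z))\<^sup>2) \<longlongrightarrow> 0) (at z)"
    by (rule smalloD_tendsto)
  have n: "((\<lambda>y. norm (y - z)) \<longlongrightarrow> 0) (at z)"
    by (auto intro!: tendsto_eq_intros)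
  have rn: "((\<lambda>y. ?r y / norm (y - z)) \<longlongrightarrow> 0) (at z)"
    using tendsto_mult[OF r n, unfolded mult_zero_left]
    by (rule Lim_transform_eventually) (simp add: eventually_at_filter power2_eq_square)
  have Qn: "((\<lambda>y. ?Q y / norm (y - z)) \<longlongrightarrow> 0) (at z)"
  proof (rule Lim_null_comparison)
    show "\<forall>\<^sub>F y in at z. norm (?Q y / norm (y - z)) \<le> norm (B *v (y - z))"
    proof (rule always_eventually, rule allI)
      fix y
      have "\<bar>(B *v (y - z)) \<bullet> (y - z)\<bar> \<le> norm (B *v (y - z)) * norm (y - z)"
        by (rule Cauchy_Schwarz_ineq2)
      moreover have "0 \<le> norm (B *v (y - z)) * norm (y - z)" by simp
      ultimately have "\<bar>?Q y\<bar> \<le> norm (B *v (y - z)) * norm (y - z)"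
        unfolding abs_mult by simp
      then show "norm (?Q y / norm (y - z)) \<le> norm (B *v (y - z))"
        by (cases "y = z") (auto simp: divide_le_eq)
    qed
    have "((\<lambda>y. y - z) \<longlongrightarrow> 0) (at z)"
      using n by (rule tendsto_norm_zero_cancel)
    then show "((\<lambda>y. norm (B *v (y - z))) \<longlongrightarrow> 0) (at z)"
      by (intro tendsto_norm_zero bounded_linear.tendsto_zero[OF matrix_vector_mul_bounded_linear])
  qed
  have eq: "?r y / norm (y - z) + ?Q y / norm (y - z) = (u y - u z - (y - z) \<bullet> q) / norm (y - z)"
    for y
    unfolding add_divide_distrib[symmetric] inner_commute[of "y - z" q] by simp
  have "((\<lambda>y. (u y - u z - (y - z) \<bullet> q) / norm (y - z)) \<longlongrightarrow> 0) (at z)"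
    using tendsto_add[OF rn Qn] unfolding eq by simp
  then have "((\<lambda>y. norm (u y - u z - (y - z) \<bullet> q) / norm (y - z)) \<longlongrightarrow> 0) (at z)"
    by (auto dest: tendsto_norm_zero)
  then show ?thesis
    unfolding gderiv_def has_derivative_iff_norm
    using bounded_linear_inner_left[of q] by blast
qed

lemma D2u_eq:
  fixes u :: "real^'n \<Rightarrow> real"
  assumes "has_peano_expansion u z q B"
  shows "D2u u z = B"
  unfolding D2u_def
proof (rule the_equality)
  show "\<exists>q. has_peano_expansion u z q B" using assms by blast
  fix B' assume "\<exists>q. has_peano_expansion u z q B'"
  then obtain q' where q': "has_peano_expansion u z q' B'" by blast
  have "q' = q"
    using Du_eq has_peano_expansion_GDERIV assms q' by metis
  define M where "M = B - B'"
  have M: "transpose M = M"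
    using assms q' unfolding M_def has_peano_expansion_def sym_matrices_def
    by (simp add: transpose_def vec_eq_iff)
  let ?r = "\<lambda>B y. u y - (u z + q \<bullet> (y - z) + 1/2 * ((B *v (y - z)) \<bullet> (y - z)))"
  have "?r B' \<in> o[at z](\<lambda>y. (norm (y - z))\<^sup>2)" "?r B \<in> o[at z](\<lambda>y. (norm (y - z))\<^sup>2)"
    using assms q' \<open>q' = q\<close> by (simp_all add: has_peano_expansion_def)
  then have "(\<lambda>y. ?r B' y - ?r B y) \<in> o[at z](\<lambda>y. (norm (y - z))\<^sup>2)"
    by (rule sum_in_smallo)
  also have "(\<lambda>y. ?r B' y - ?r B y) = (\<lambda>y. 1/2 * ((M *v (y - z)) \<bullet> (y - z)))"
    by (simp add: M_def fun_eq_iff matrix_vector_mult_diff_rdistrib inner_diff_left algebra_simps)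
  finally have lim: "((\<lambda>y. 1/2 * ((M *v (y - z)) \<bullet> (y - z)) / (norm (y - z))\<^sup>2) \<longlongrightarrow> 0) (at z)"
    by (rule smalloD_tendsto)
  have quad: "(M *v v) \<bullet> v = 0" for v
  proof (cases "v = 0")
    case False
    have t: "filterlim (\<lambda>t::real. z + t *\<^sub>R v) (at z) (at 0)"
      unfolding filterlim_at
      using False by (auto intro!: tendsto_eq_intros simp: eventually_at_filter)
    have "((\<lambda>t::real. 1/2 * ((M *v v) \<bullet> v) / (norm v)\<^sup>2) \<longlongrightarrow> 0) (at 0)"
      by (rule Lim_transform_eventually[OF filterlim_compose[OF lim t]])
        (simp add: eventually_at_filter matrix_vector_mult_scaleR power_mult_distrib,
         simp add: power2_eq_square)
    then have "1/2 * ((M *v v) \<bullet> v) / (norm v)\<^sup>2 = 0"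
      by (subst (asm) tendsto_const_iff) auto
    then show ?thesis using False by simp
  qed simp
  have "M = 0"
  proof -
    have "(M *v v) \<bullet> w = 0" for v w
    proof -
      have "(M *v w) \<bullet> v = (M *v v) \<bullet> w"
        using M by (metis dot_lmul_matrix inner_commute transpose_matrix_vector)
      then show ?thesis
        using quad[of "v + w"] quad[of v] quad[of w]
        by (simp add: matrix_vector_right_distrib inner_add_left inner_add_right)
    qed
    then have "M *v v = 0" for v
      using inner_eq_zero_iff by blast
    then show ?thesis by (metis matrix_eq matrix_vector_mult_0)
  qed
  then show "B' = B" by (simp add: M_def)
qed

end

theory Submission
  imports Defs
begin

text \<open>Adding a multiple of the squared norm reduces everything to convex functions. At a point of upper
contact, \<open>u\<close> lies below a quadratic polynomial, and convexity reflects this bound at the point, so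
\<open>u\<close> differs from an affine function by a quadratic error (\<open>upper_contact_GDERIV\<close>). This gives
differentiability and identifies the first component of every upper contact jet.

The approximating sequence rests on two facts of opposite nature. First, the points where \<open>u\<close> fails
to be twice differentiable form a null set (Alexandrov's theorem, \<open>alexandrov\<close>). Second, the points
near \<open>x\<close> at which \<open>u\<close> has upper contact jets close to \<open>(p, A)\<close> do not fit into a null set (the
lemma of Jensen and Slodkowski, \<open>linear_perturbation_maximum\<close>): they are the maximum points of small
linear tilts of a function with a strict maximum at \<open>x\<close>, and the tilt depends on the maximum point
in a Lipschitz way. Hence some of these points lie in \<open>E\<close> and are points of twice
differentiability. There the contact jet determines the gradient and bounds the Hessian from above,
while semiconvexity bounds it from below; a convergent subsequence of Hessians gives the limit
matrix (\<open>nearby_peano_point\<close>, \<open>convergent_peano_sequence\<close>).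

Alexandrov's theorem follows from Rademacher's. The subdifferential of a convex function is
monotone, so the map \<open>x + \<xi> \<mapsto> x\<close>, for subgradients \<open>\<xi>\<close> at \<open>x\<close>, is non-expansive and extends to a
Lipschitz map. Outside a null set of points \<open>x\<close> it is differentiable with invertible derivative at
\<open>x + \<xi>\<close> (Rademacher and Sard); inverting it expands the subdifferential to first order at \<open>x\<close>, and
integration along segments expands the function to second order.

Rademacher's theorem for a real-valued function starts on the line: where difference quotients
oscillate between \<open>p\<close> and \<open>q\<close>, a covering argument compares the measure of a set with that of its
image in two incompatible ways (\<open>null_sets_oscillation_set_real\<close>). Fubini's theorem carries this to
lines in a fixed direction, integration over compact sets shows that the directional derivatives are
additive in the direction almost everywhere, and a countable dense set of directions suffices for
full differentiability (\<open>rademacher\<close>).\<close>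

section \<open>Oscillation of difference quotients on the line\<close>

text \<open>An increasing function multiplies lengths by at most \<open>p\<close> on a set of points that lie in arbitrarily
short intervals of mean slope at most \<open>p\<close>: by Vitali's theorem disjoint intervals of this kind,
inside an open set barely larger than \<open>E\<close>, exhaust \<open>E\<close> up to a null set, and the Lipschitz map
\<open>g\<close> sends that remainder to a null set.\<close>

lemma emeasure_image_le_of_slopes:
  fixes g :: "real \<Rightarrow> real"
  assumes E: "E \<in> sets lebesgue" "g ` E \<in> sets lebesgue"
    and g: "strict_mono g" "L-lipschitz_on UNIV g" and p: "p \<ge> 0"
    and slope: "\<And>x e. x \<in> E \<Longrightarrow> e > 0 \<Longrightarrow>
      \<exists>c d. c < d \<and> x \<in> {c..d} \<and> d - c < e \<and> g d - g c \<le> p * (d - c)"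
  shows "emeasure lebesgue (g ` E) \<le> ennreal p * emeasure lebesgue E"
proof (rule ennreal_le_epsilon)
  fix e0 :: real assume "0 < e0"
  \<comment> \<open>The excess measure \<open>e\<close> of the open set is multiplied by \<open>p\<close> below.\<close>
  define e where "e = e0 / (p + 1)"
  have e: "e > 0" "p * e \<le> e0"
    using \<open>0 < e0\<close> p by (auto simp: e_def field_simps)
  obtain U where U: "open U" "E \<subseteq> U" "U - E \<in> lmeasurable" "emeasure lebesgue (U - E) < ennreal e"
    using sets_lebesgue_outer_open[OF E(1) e(1)] .
  define K where "K = {(c, d). c < d \<and> {c..d} \<subseteq> U \<and> g d - g c \<le> p * (d - c)}"
  define I where "I = (\<lambda>(c::real, d::real). {c..d})"
  define a where "a = (\<lambda>i::real \<times> real. (fst i + snd i) / 2)"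
  define r where "r = (\<lambda>i::real \<times> real. (snd i - fst i) / 2)"
  have cball: "cball (a i) (r i) = I i" for i
    by (auto simp: I_def a_def r_def cball_eq_atLeastAtMost field_simps split: prod.split)
  have rK: "0 < r i" if "i \<in> K" for i
    using that by (auto simp: K_def r_def)
  have fine: "\<exists>i. i \<in> K \<and> x \<in> cball (a i) (r i) \<and> r i < d" if x: "x \<in> E" "0 < d" for x d
  proof -
    obtain s where s: "s > 0" "ball x s \<subseteq> U"
      using U x by (meson openE subsetD)
    obtain c c' where cc: "c < c'" "x \<in> {c..c'}" "c' - c < min d s" "g c' - g c \<le> p * (c' - c)"
      using slope[of x "min d s"] x s by auto
    have "{c..c'} \<subseteq> ball x s"
      using cc by (auto simp: dist_real_def)
    then have "(c, c') \<in> K"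
      using cc s by (auto simp: K_def)
    then show ?thesis
      unfolding cball using cc by (intro exI[of _ "(c, c')"]) (auto simp: I_def r_def)
  qed
  obtain C where C: "countable C" "C \<subseteq> K"
    "pairwise (\<lambda>i j. disjnt (I i) (I j)) C" "negligible (E - (\<Union>i\<in>C. I i))"
    using Vitali_covering_theorem_cballs[OF rK fine] unfolding cball by metis
  define J where "J = (\<lambda>(c, d). {g c..g d})"
  have disj: "disjoint_family_on I C"
    using C(3) by (auto simp: disjoint_family_on_def pairwise_def disjnt_def)
  have le: "c < d \<and> g c < g d" if "(c, d) \<in> C" for c d
    using that C(2) g(1) by (auto simp: K_def strict_mono_def)
  have disjJ: "disjoint_family_on J C"
    unfolding disjoint_family_on_def
  proof (intro ballI impI)
    fix i j assume ij: "i \<in> C" "j \<in> C" "i \<noteq> j"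
    obtain a b c d where abcd: "i = (a, b)" "j = (c, d)" by (metis surj_pair)
    have "{a..b} \<inter> {c..d} = {}"
      using disj ij unfolding disjoint_family_on_def abcd I_def by fastforce
    moreover have "a < b" "c < d"
      using le ij abcd by auto
    ultimately have "b < c \<or> d < a"
      by (smt (verit) disjoint_iff atLeastAtMost_iff)
    then have "g b < g c \<or> g d < g a"
      using g(1) by (auto simp: strict_mono_def)
    then show "J i \<inter> J j = {}"
      unfolding J_def abcd by auto
  qed
  define N where "N = g ` (E - (\<Union>i\<in>C. I i))"
  have N: "N \<in> null_sets lebesgue"
    unfolding negligible_iff_null_sets[symmetric] N_def
  proof (rule negligible_locally_Lipschitz_image)
    fix x assume "x \<in> E - (\<Union>i\<in>C. I i)"
    show "\<exists>T B. open T \<and> x \<in> T \<and>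
      (\<forall>y\<in>(E - (\<Union>i\<in>C. I i)) \<inter> T. norm (g y - g x) \<le> B * norm (y - x))"
      using lipschitz_onD[OF g(2)] by (intro exI[of _ UNIV] exI[of _ L]) (auto simp: dist_norm)
  qed (use C in auto)
  have J_sets: "(\<Union>i\<in>C. J i) \<in> sets lebesgue" "(\<Union>i\<in>C. I i) \<in> sets lebesgue"
    using C(1) by (auto simp: J_def I_def)
  have "g ` E \<subseteq> (\<Union>i\<in>C. J i) \<union> N"
    using g(1) unfolding N_def J_def I_def
    by (fastforce simp: strict_mono_less_eq image_iff)
  then have "emeasure lebesgue (g ` E) \<le> emeasure lebesgue ((\<Union>i\<in>C. J i) \<union> N)"
    using J_sets N by (intro emeasure_mono) auto
  also have "\<dots> = emeasure lebesgue (\<Union>i\<in>C. J i)"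
    using J_sets N by (simp add: emeasure_Un_null_set)
  also have "\<dots> = (\<integral>\<^sup>+i. emeasure lebesgue (J i) \<partial>count_space C)"
    using C disjJ by (intro emeasure_UN_countable) (auto simp: J_def)
  also have "\<dots> \<le> (\<integral>\<^sup>+i. ennreal p * emeasure lebesgue (I i) \<partial>count_space C)"
  proof (rule nn_integral_mono)
    fix i assume "i \<in> space (count_space C)"
    then obtain c d where i: "i = (c, d)" "(c, d) \<in> C" by (cases i) auto
    then have "g d - g c \<le> p * (d - c)" using C(2) by (auto simp: K_def)
    then show "emeasure lebesgue (J i) \<le> ennreal p * emeasure lebesgue (I i)"
      using le[OF i(2)] p unfolding i(1) J_def I_def
      by (simp add: less_imp_le flip: ennreal_mult ennreal_le_iff)
  qed
  also have "\<dots> = ennreal p * emeasure lebesgue (\<Union>i\<in>C. I i)"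
    using C disj
    by (subst emeasure_UN_countable) (auto simp: I_def nn_integral_cmult)
  also have "\<dots> \<le> ennreal p * emeasure lebesgue (E \<union> (U - E))"
    using C(2) E U by (intro mult_left_mono emeasure_mono) (auto simp: K_def I_def)
  also have "\<dots> \<le> ennreal p * (emeasure lebesgue E + ennreal e)"
  proof (intro mult_left_mono)
    have "emeasure lebesgue (E \<union> (U - E)) \<le> emeasure lebesgue E + emeasure lebesgue (U - E)"
      using U E by (intro emeasure_subadditive) auto
    also have "\<dots> \<le> emeasure lebesgue E + ennreal e"
      using U by (intro add_left_mono less_imp_le)
    finally show "emeasure lebesgue (E \<union> (U - E)) \<le> emeasure lebesgue E + ennreal e" .
  qed simp
  also have "\<dots> \<le> ennreal p * emeasure lebesgue E + ennreal e0"
    using e p by (simp add: distrib_left ennreal_leI add_left_mono flip: ennreal_mult)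
  finally show "emeasure lebesgue (g ` E) \<le> ennreal p * emeasure lebesgue E + ennreal e0" .
qed

definition difference_quotient :: "('a::real_normed_vector \<Rightarrow> real) \<Rightarrow> 'a \<Rightarrow> 'a \<Rightarrow> real \<Rightarrow> real" where
  "difference_quotient f v x t = (f (x + t *\<^sub>R v) - f x) / t"

text \<open>Points where the quotients in direction \<open>v\<close> at arbitrarily small increments keep falling below
\<open>p\<close> and rising above \<open>q\<close>; for \<open>p < q\<close> the directional derivative fails to exist there.\<close>

definition oscillation_set :: "('a::real_normed_vector \<Rightarrow> real) \<Rightarrow> 'a \<Rightarrow> real \<Rightarrow> real \<Rightarrow> 'a set" where
  "oscillation_set f v p q = {x. \<forall>n::nat.
     (\<exists>t. t \<noteq> 0 \<and> \<bar>t\<bar> < inverse (Suc n) \<and> difference_quotient f v x t < p) \<and>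
     (\<exists>t. t \<noteq> 0 \<and> \<bar>t\<bar> < inverse (Suc n) \<and> q < difference_quotient f v x t)}"

lemma continuous_on_difference_quotient:
  fixes f :: "'a::real_normed_vector \<Rightarrow> real"
  assumes "continuous_on UNIV f"
  shows "continuous_on UNIV (\<lambda>x. difference_quotient f v x t)"
  unfolding difference_quotient_def divide_inverse
  by (intro continuous_intros continuous_on_compose2[OF assms]) auto

text \<open>For each fixed increment the set of points where the quotient satisfies a strict bound is open,
so unions over uncountably many increments are harmless and the oscillation set is a \<open>G\<^sub>\<delta>\<close>.\<close>

lemma borel_oscillation_set:
  fixes f :: "'a::euclidean_space \<Rightarrow> real"
  assumes "continuous_on UNIV f"
  shows "oscillation_set f v p q \<in> sets borel"
proof -
  have *: "oscillation_set f v p q = (\<Inter>n::nat.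
     (\<Union>t\<in>{t. t \<noteq> 0 \<and> \<bar>t\<bar> < inverse (Suc n)}. {x. difference_quotient f v x t < p}) \<inter>
     (\<Union>t\<in>{t. t \<noteq> 0 \<and> \<bar>t\<bar> < inverse (Suc n)}. {x. q < difference_quotient f v x t}))"
    unfolding oscillation_set_def by blast
  have op: "open {x. difference_quotient f v x t < p}" "open {x. q < difference_quotient f v x t}" for t
    using continuous_on_difference_quotient[OF assms, of v t]
    by (auto intro!: open_Collect_less continuous_intros)
  show ?thesis
    unfolding * by (intro sets.countable_INT'' borel_open open_Int open_UN) (auto intro: op)
qed

text \<open>Oscillation in direction \<open>v\<close> is a one-dimensional phenomenon on each line parallel to \<open>v\<close>.\<close>

lemma oscillation_set_line:
  "(s \<in> oscillation_set (\<lambda>s. f (x + s *\<^sub>R v)) 1 p q) \<longleftrightarrow> (x + s *\<^sub>R v \<in> oscillation_set f v p q)"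
  unfolding oscillation_set_def difference_quotient_def by (simp add: algebra_simps)

text \<open>The slopes of \<open>f\<close> near a point of the oscillation set are infinitely often below \<open>p\<close> and
infinitely often above \<open>q\<close>. Adding \<open>(L + 1) * x\<close> gives a bi-Lipschitz increasing
function \<open>g\<close> with the bounds \<open>p' = p + L + 1\<close> and \<open>q' = q + L + 1\<close>. Low slopes of \<open>g\<close> bound the length of \<open>g ` E\<close> by \<open>p'\<close> times that of \<open>E\<close>; high slopes
of \<open>g\<close> are low slopes of its inverse \<open>h\<close> and bound the length of \<open>E\<close> by \<open>1 / q'\<close> times that of
\<open>g ` E\<close>. Both can hold with \<open>p' < q'\<close> only if \<open>E\<close> is null.\<close>

lemma null_sets_oscillation_set_real:
  fixes f :: "real \<Rightarrow> real"
  assumes lip: "L-lipschitz_on UNIV f" and pq: "p < q"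
  shows "oscillation_set f 1 p q \<in> null_sets lebesgue"
proof (cases "oscillation_set f 1 p q = {}")
  case False
  define S where "S = oscillation_set f 1 p q"
  have L: "L \<ge> 0" using lip lipschitz_on_nonneg by blast
  \<comment> \<open>Adding \<open>m * x\<close> moves all slopes into the interval from \<open>1\<close> to \<open>2 * L + 1\<close>.\<close>
  define m where "m = L + 1"
  define g where "g = (\<lambda>x. f x + m * x)"
  have fb: "\<bar>f b - f a\<bar> \<le> L * (b - a)" if "a \<le> b" for a b
    using lipschitz_onD[OF lip, of b a] that by (simp add: dist_real_def)
  have slope1: "b - a \<le> g b - g a" "g b - g a \<le> (2 * L + 1) * (b - a)" if "a \<le> b" for a b
    using fb[OF that] by (auto simp: g_def m_def algebra_simps abs_le_iff)
  have mono: "strict_mono g"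
    using slope1 by (intro strict_monoI) (smt (verit))
  have glip: "(2 * L + 1)-lipschitz_on UNIV g"
  proof (rule lipschitz_onI)
    fix x y show "dist (g x) (g y) \<le> (2 * L + 1) * dist x y"
      using slope1[of x y] slope1[of y x] by (cases "x \<le> y") (auto simp: dist_real_def)
  qed (use L in auto)
  have gcont: "continuous_on UNIV g" using glip by (rule lipschitz_on_continuous_on)
  have surj: "\<exists>x. g x = y" for y
  proof -
    define r where "r = \<bar>y - g 0\<bar>"
    have "g (- r) \<le> y" "y \<le> g r"
      using slope1[of "-r" 0] slope1[of 0 r] by (auto simp: r_def)
    then show ?thesis
      using IVT'[of g "-r" y r] gcont continuous_on_subset by (fastforce simp: r_def)
  qed
  define h where "h = inv g"
  have hg: "h (g x) = x" and gh: "g (h y) = y" for x y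
    using strict_mono_imp_inj_on[OF mono] surj[of y]
    by (auto simp: h_def inv_f_f surj_f_inv_f f_inv_into_f image_iff)
  have hmono: "strict_mono h"
    by (rule strict_monoI) (metis gh mono strict_mono_less)
  have hlip: "1-lipschitz_on UNIV h"
  proof (rule lipschitz_onI)
    fix x y show "dist (h x) (h y) \<le> 1 * dist x y"
      using slope1(1)[of "h x" "h y"] slope1(1)[of "h y" "h x"]
      by (cases "h x \<le> h y") (auto simp: dist_real_def gh)
  qed auto
  have himg: "g ` A = h -` A" for A using hg gh by (auto simp: image_iff) (metis gh)
  define p' where "p' = p + m"
  define q' where "q' = q + m"
  \<comment> \<open>A quotient of either sign of increment is the mean slope over an interval ending at \<open>x\<close>.\<close>
  have quot: "difference_quotient f 1 x t + m = (g (max x (x + t)) - g (min x (x + t))) / \<bar>t\<bar>" 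
    "max x (x + t) - min x (x + t) = \<bar>t\<bar>" if "t \<noteq> 0" for x t
    using that by (auto simp: difference_quotient_def g_def max_def min_def field_simps)
  have low: "\<exists>c d. c < d \<and> x \<in> {c..d} \<and> d - c < e \<and> g d - g c \<le> p' * (d - c)"
    if "x \<in> S" "e > 0" for x e
  proof -
    obtain n where n: "inverse (real (Suc n)) < e" using reals_Archimedean[OF \<open>e > 0\<close>] by auto
    obtain t where t: "t \<noteq> 0" "\<bar>t\<bar> < inverse (Suc n)" "difference_quotient f 1 x t < p"
      using \<open>x \<in> S\<close> unfolding S_def oscillation_set_def by blast
    let ?c = "min x (x + t)" and ?d = "max x (x + t)"
    have "g ?d - g ?c = (difference_quotient f 1 x t + m) * (?d - ?c)"
      using quot[OF t(1), of x] t(1) by simp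
    moreover have "?c < ?d" "?d - ?c < e" "x \<in> {?c..?d}"
      using t n quot(2)[OF t(1), of x] by auto
    ultimately have "g ?d - g ?c \<le> p' * (?d - ?c)"
      using t(3) by (auto simp: p'_def intro!: mult_right_mono)
    then show ?thesis
      using \<open>?c < ?d\<close> \<open>?d - ?c < e\<close> \<open>x \<in> {?c..?d}\<close> by blast
  qed
  have high: "\<exists>c d. c < d \<and> x \<in> {c..d} \<and> d - c < e \<and> q' * (d - c) \<le> g d - g c"
    if "x \<in> S" "e > 0" for x e
  proof -
    obtain n where n: "inverse (real (Suc n)) < e" using reals_Archimedean[OF \<open>e > 0\<close>] by auto
    obtain t where t: "t \<noteq> 0" "\<bar>t\<bar> < inverse (Suc n)" "q < difference_quotient f 1 x t"
      using \<open>x \<in> S\<close> unfolding S_def oscillation_set_def by blast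
    let ?c = "min x (x + t)" and ?d = "max x (x + t)"
    have "g ?d - g ?c = (difference_quotient f 1 x t + m) * (?d - ?c)"
      using quot[OF t(1), of x] t(1) by simp
    moreover have "?c < ?d" "?d - ?c < e" "x \<in> {?c..?d}"
      using t n quot(2)[OF t(1), of x] by auto
    ultimately have "q' * (?d - ?c) \<le> g ?d - g ?c"
      using t(3) by (auto simp: q'_def intro!: mult_right_mono)
    then show ?thesis
      using \<open>?c < ?d\<close> \<open>?d - ?c < e\<close> \<open>x \<in> {?c..?d}\<close> by blast
  qed
  have p': "0 < p'"
  proof -
    obtain x where "x \<in> S" using False by (auto simp: S_def)
    then obtain c d where "c < d" "g d - g c \<le> p' * (d - c)" using low[of x 1] by auto
    then have "0 < p' * (d - c)" using slope1(1)[of c d] by linarith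
    then show ?thesis using \<open>c < d\<close> by (simp add: zero_less_mult_iff)
  qed
  have q': "p' < q'" using pq by (simp add: p'_def q'_def)
  have S: "S \<in> sets borel"
    unfolding S_def using lip lipschitz_on_continuous_on borel_oscillation_set by blast
  have null: "S \<inter> cbox (- real n) (real n) \<in> null_sets lebesgue" for n :: nat
  proof -
    define E where "E = S \<inter> cbox (- real n) (real n)"
    have E: "E \<in> sets borel" using S by (simp add: E_def)
    have "g ` E \<in> sets borel"
      unfolding himg
      using measurable_sets[OF borel_measurable_continuous_onI[OF lipschitz_on_continuous_on[OF hlip]] E]
      by simp
    then have E': "E \<in> sets lebesgue" "g ` E \<in> sets lebesgue" "h ` g ` E = E"
      using E hg by (auto simp: image_image)
    have 1: "emeasure lebesgue (g ` E) \<le> ennreal p' * emeasure lebesgue E"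
      by (rule emeasure_image_le_of_slopes[OF E'(1,2) mono glip])
        (use p' low in \<open>auto simp: E_def\<close>)
    have 2: "emeasure lebesgue (h ` (g ` E)) \<le> ennreal (1 / q') * emeasure lebesgue (g ` E)"
    proof (rule emeasure_image_le_of_slopes[OF _ _ hmono hlip])
      fix y e :: real assume y: "y \<in> g ` E" and "e > 0"
      then obtain x where x: "x \<in> S" "y = g x" by (auto simp: E_def)
      have "e / (2 * L + 1) > 0" using \<open>e > 0\<close> L by auto
      from high[OF x(1) this] obtain c d where
        cd: "c < d" "x \<in> {c..d}" "d - c < e / (2 * L + 1)" "q' * (d - c) \<le> g d - g c" by auto
      have "(2 * L + 1) * (d - c) < e" using cd L by (simp add: field_simps)
      then have "g d - g c < e" using slope1(2)[of c d] cd by linarith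
      then show "\<exists>c d. c < d \<and> y \<in> {c..d} \<and> d - c < e \<and> h d - h c \<le> 1 / q' * (d - c)"
        using cd mono q' p' x
        by (intro exI[of _ "g c"] exI[of _ "g d"])
           (auto simp: hg strict_mono_less strict_mono_less_eq field_simps)
    qed (use E' p' q' in auto)
    have fin: "emeasure lebesgue E < \<infinity>"
    proof -
      have "E \<in> lmeasurable"
        using E'(1) by (intro bounded_set_imp_lmeasurable) (auto simp: E_def intro: bounded_subset[of "cbox (- real n) (real n)"])
      then show ?thesis by (simp add: fmeasurable_def del: emeasure_completion)
    qed
    define r where "r = measure lebesgue E"
    have r: "emeasure lebesgue E = ennreal r" "r \<ge> 0"
      using fin by (auto simp: r_def emeasure_eq_ennreal_measure)
    have "emeasure lebesgue E \<le> ennreal (1 / q') * (ennreal p' * emeasure lebesgue E)"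
      using order_trans[OF 2 mult_left_mono[OF 1]] unfolding E'(3) by simp
    then have "r \<le> 1 / q' * (p' * r)"
      unfolding r using r p' q' by (simp flip: ennreal_mult)
    then have "r * (q' - p') \<le> 0" using p' q' by (simp add: field_simps)
    then have "r = 0" using q' r by (simp add: mult_le_0_iff)
    then show ?thesis using r E' unfolding E_def[symmetric] by (auto intro!: null_setsI)
  qed
  have "S = (\<Union>n::nat. S \<inter> cbox (- real n) (real n))"
  proof -
    have "\<exists>n::nat. x \<in> cbox (- real n) (real n)" for x
    proof -
      obtain n :: nat where "\<bar>x\<bar> \<le> real n" using real_arch_simple by blast
      then show ?thesis by (intro exI[of _ n]) (auto simp: abs_le_iff)
    qed
    then show ?thesis by auto
  qed
  moreover have "(\<Union>n::nat. S \<inter> cbox (- real n) (real n)) \<in> null_sets lebesgue"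
    using null by (rule null_sets_UN)
  ultimately show ?thesis by (simp add: S_def)
qed auto

section \<open>Directional derivatives almost everywhere\<close>

text \<open>Fubini for lines in an arbitrary direction without rotating coordinates: integrate the
indicator of \<open>S\<close> at \<open>x + s *\<^sub>R v\<close> over all \<open>x\<close> and over \<open>0 \<le> s \<le> 1\<close>. Integrating in \<open>s\<close> first gives
zero; integrating in \<open>x\<close> first gives the measure of \<open>S\<close>, by translation invariance.\<close>

lemma null_sets_of_null_lines:
  fixes S :: "'a::euclidean_space set"
  assumes S[measurable]: "S \<in> sets borel"
    and lines: "\<And>x. {s. x + s *\<^sub>R v \<in> S} \<in> null_sets lborel"
  shows "S \<in> null_sets lborel"
proof -
  let ?F = "\<lambda>(x, s). indicator S (x + s *\<^sub>R v) * indicator {0..1::real} s :: ennreal"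
  have [measurable]: "?F \<in> borel_measurable (lborel \<Otimes>\<^sub>M lborel)"
    by measurable
  have "(\<integral>\<^sup>+s. ?F (x, s) \<partial>lborel) = 0" for x
  proof -
    have "(\<integral>\<^sup>+s. ?F (x, s) \<partial>lborel) \<le> (\<integral>\<^sup>+s. indicator {s. x + s *\<^sub>R v \<in> S} s \<partial>lborel)"
      by (intro nn_integral_mono) (auto split: split_indicator)
    also have "\<dots> = 0"
      using lines[of x] by (subst nn_integral_indicator) auto
    finally show ?thesis by simp
  qed
  then have "0 = (\<integral>\<^sup>+x. (\<integral>\<^sup>+s. ?F (x, s) \<partial>lborel) \<partial>lborel)"
    by simp
  also have "\<dots> = (\<integral>\<^sup>+s. (\<integral>\<^sup>+x. ?F (x, s) \<partial>lborel) \<partial>lborel)"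
    by (rule lborel_pair.Fubini[symmetric]) measurable
  also have "\<dots> = (\<integral>\<^sup>+s. emeasure lborel S * indicator {0..1::real} s \<partial>lborel)"
  proof (rule nn_integral_cong)
    fix s :: real
    have "(\<integral>\<^sup>+x. indicator S (x + s *\<^sub>R v) \<partial>lborel) =
        (\<integral>\<^sup>+x. indicator S x \<partial>distr lborel borel ((+) (s *\<^sub>R v)))"
      by (subst nn_integral_distr) (auto simp: add.commute)
    also have "\<dots> = emeasure lborel S"
      by (simp add: lborel_distr_plus)
    finally show "(\<integral>\<^sup>+x. ?F (x, s) \<partial>lborel) = emeasure lborel S * indicator {0..1::real} s"
      by (simp add: nn_integral_multc)
  qed
  also have "\<dots> = emeasure lborel S"
    by (simp add: nn_integral_cmult)
  finally show ?thesis by (auto intro: null_setsI)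
qed

lemma null_sets_oscillation_set:
  fixes f :: "'a::euclidean_space \<Rightarrow> real"
  assumes lip: "L-lipschitz_on UNIV f" and pq: "p < q"
  shows "oscillation_set f v p q \<in> null_sets lborel"
proof (rule null_sets_of_null_lines)
  show "oscillation_set f v p q \<in> sets borel"
    using lip lipschitz_on_continuous_on borel_oscillation_set by blast
  fix x
  have L: "L \<ge> 0" using lip lipschitz_on_nonneg by blast
  have line: "(L * norm v)-lipschitz_on UNIV (\<lambda>s. f (x + s *\<^sub>R v))"
  proof (rule lipschitz_onI)
    fix s t :: real
    have "dist (f (x + s *\<^sub>R v)) (f (x + t *\<^sub>R v)) \<le> L * dist (x + s *\<^sub>R v) (x + t *\<^sub>R v)"
      using lip by (rule lipschitz_onD) auto
    also have "\<dots> = L * norm v * dist s t"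
      by (simp add: dist_norm flip: scaleR_diff_left)
    finally show "dist (f (x + s *\<^sub>R v)) (f (x + t *\<^sub>R v)) \<le> L * norm v * dist s t" .
  qed (use L in auto)
  have eq: "{s. x + s *\<^sub>R v \<in> oscillation_set f v p q} = oscillation_set (\<lambda>s. f (x + s *\<^sub>R v)) 1 p q"
    by (auto simp: oscillation_set_line)
  have "oscillation_set (\<lambda>s. f (x + s *\<^sub>R v)) 1 p q \<in> sets borel"
    using line lipschitz_on_continuous_on borel_oscillation_set by blast
  then show "{s. x + s *\<^sub>R v \<in> oscillation_set f v p q} \<in> null_sets lborel"
    using null_sets_oscillation_set_real[OF line pq] unfolding eq
    by (simp add: null_sets_completion_iff)
qed

lemma abs_difference_quotient_le:
  fixes f :: "'a::real_normed_vector \<Rightarrow> real"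
  assumes "L-lipschitz_on UNIV f"
  shows "\<bar>difference_quotient f v x t\<bar> \<le> L * norm v"
proof -
  have L: "L \<ge> 0" using assms lipschitz_on_nonneg by blast
  have "\<bar>f (x + t *\<^sub>R v) - f x\<bar> \<le> L * (\<bar>t\<bar> * norm v)"
    using lipschitz_onD[OF assms, of "x + t *\<^sub>R v" x] by (simp add: dist_norm)
  then show ?thesis
    using L by (cases "t = 0") (auto simp: difference_quotient_def field_simps)
qed

text \<open>If the bounded quotient had no limit, rationals \<open>p < q\<close> would fit between its lower and upper
limits.\<close>

lemma difference_quotient_convergent_if_no_oscillation:
  fixes f :: "'a::real_normed_vector \<Rightarrow> real"
  assumes lip: "L-lipschitz_on UNIV f"
    and no: "\<And>p q. p \<in> \<rat> \<Longrightarrow> q \<in> \<rat> \<Longrightarrow> p < q \<Longrightarrow> x \<notin> oscillation_set f v p q"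
  shows "\<exists>D. (difference_quotient f v x \<longlongrightarrow> D) (at 0)"
proof -
  define F where "F = (\<lambda>t. ereal (difference_quotient f v x t))"
  define M where "M = L * norm v"
  have M: "- M \<le> difference_quotient f v x t" "difference_quotient f v x t \<le> M" for t
    using abs_difference_quotient_le[OF lip, of v x t] by (auto simp: M_def abs_le_iff)
  have nbot: "at (0::real) \<noteq> bot" by simp
  have "\<not> Liminf (at 0) F < Limsup (at 0) F"
  proof
    assume "Liminf (at 0) F < Limsup (at 0) F"
    then obtain p where p: "Liminf (at 0) F < ereal (real_of_rat p)" "ereal (real_of_rat p) < Limsup (at 0) F"
      using ereal_dense3 by blast
    then obtain q where q: "ereal (real_of_rat p) < ereal (real_of_rat q)" "ereal (real_of_rat q) < Limsup (at 0) F"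
      using ereal_dense3 by blast
    have "x \<in> oscillation_set f v (real_of_rat p) (real_of_rat q)"
      unfolding oscillation_set_def
    proof (intro CollectI allI conjI)
      fix n :: nat
      show "\<exists>t. t \<noteq> 0 \<and> \<bar>t\<bar> < inverse (Suc n) \<and> difference_quotient f v x t < real_of_rat p"
      proof (rule ccontr)
        assume "\<not> ?thesis"
        then have "\<forall>\<^sub>F t in at 0. ereal (real_of_rat p) \<le> F t"
          unfolding eventually_at F_def by (intro exI[of _ "inverse (real (Suc n))"]) (auto simp: dist_real_def not_less)
        then show False using Liminf_bounded p(1) leD by blast
      qed
      show "\<exists>t. t \<noteq> 0 \<and> \<bar>t\<bar> < inverse (Suc n) \<and> real_of_rat q < difference_quotient f v x t"
      proof (rule ccontr)
        assume "\<not> ?thesis"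
        then have "\<forall>\<^sub>F t in at 0. F t \<le> ereal (real_of_rat q)"
          unfolding eventually_at F_def by (intro exI[of _ "inverse (real (Suc n))"]) (auto simp: dist_real_def not_less)
        then show False using Limsup_bounded q(2) leD by blast
      qed
    qed
    then show False using no[of "real_of_rat p" "real_of_rat q"] q(1) by simp
  qed
  then have eq: "Limsup (at 0) F = Liminf (at 0) F"
    using Liminf_le_Limsup[OF nbot, of F] by auto
  have "ereal (- M) \<le> Liminf (at 0) F" "Limsup (at 0) F \<le> ereal M"
    using M by (auto intro!: Liminf_bounded Limsup_bounded simp: F_def)
  then obtain D where D: "Liminf (at 0) F = ereal D"
    using eq by (cases "Liminf (at 0) F") auto
  have "(F \<longlongrightarrow> ereal D) (at 0)"
    using Liminf_eq_Limsup[OF nbot D] D eq by simp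
  then show ?thesis unfolding F_def by auto
qed

lemma AE_difference_quotient_convergent:
  fixes f :: "'a::euclidean_space \<Rightarrow> real"
  assumes lip: "L-lipschitz_on UNIV f"
  shows "AE x in lborel. \<exists>D. (difference_quotient f v x \<longlongrightarrow> D) (at 0)"
proof (rule AE_I')
  let ?P = "{(p, q). p \<in> \<rat> \<and> q \<in> \<rat> \<and> p < (q::real)}"
  have "countable (\<rat> \<times> \<rat> :: (real \<times> real) set)" by (simp add: countable_rat)
  then have "countable ?P" by (rule countable_subset[rotated]) auto
  then show "(\<Union>pq\<in>?P. oscillation_set f v (fst pq) (snd pq)) \<in> null_sets lborel"
    using null_sets_oscillation_set[OF lip] by (intro null_sets_UN') auto
  show "{x \<in> space lborel. \<not> (\<exists>D. (difference_quotient f v x \<longlongrightarrow> D) (at 0))} \<subseteq> (\<Union>pq\<in>?P. oscillation_set f v (fst pq) (snd pq))"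
  proof safe
    fix x assume "\<nexists>D. (difference_quotient f v x \<longlongrightarrow> D) (at 0)"
    then obtain p q where "p \<in> \<rat>" "q \<in> \<rat>" "p < q" "x \<in> oscillation_set f v p q"
      using difference_quotient_convergent_if_no_oscillation[OF lip] by blast
    then show "x \<in> (\<Union>pq\<in>?P. oscillation_set f v (fst pq) (snd pq))"
      by (intro UN_I[of "(p, q)"]) auto
  qed
qed

section \<open>Additivity of directional derivatives\<close>

text \<open>Otherwise, by inner regularity, some compact set of positive measure would carry a positive
lower bound of \<open>h\<close>.\<close>

lemma AE_nonpos_of_compact_integrals:
  fixes h :: "'a::euclidean_space \<Rightarrow> real"
  assumes h[measurable]: "h \<in> borel_measurable borel"
    and int: "\<And>K. compact K \<Longrightarrow> integrable lborel (\<lambda>x. indicator K x * h x)"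
    and nonpos: "\<And>K. compact K \<Longrightarrow> (\<integral>x. indicator K x * h x \<partial>lborel) \<le> 0"
  shows "AE x in lborel. h x \<le> 0"
proof -
  define P where "P = (\<lambda>k m. {x. inverse (real (Suc k)) < h x} \<inter> cball 0 (real m))"
  have [measurable]: "P k m \<in> sets borel" for k m unfolding P_def by measurable
  have "P k m \<in> null_sets lborel" for k m
  proof (rule ccontr)
    assume "P k m \<notin> null_sets lborel"
    then have pos: "emeasure lborel (P k m) > 0"
      by (auto simp: null_sets_def zero_less_iff_neq_zero)
    have bP: "bounded (P k m)" by (auto simp: P_def intro: bounded_subset[of "cball 0 (real m)"])
    have "P k m \<in> lmeasurable"
      using bP by (intro bounded_set_imp_lmeasurable) auto
    then have fin: "emeasure lebesgue (P k m) = ennreal (measure lebesgue (P k m))"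
      by (intro emeasure_eq_measure2)
    have "measure lebesgue (P k m) > 0"
      using pos fin by (auto simp: ennreal_less_zero_iff)
    from sets_lebesgue_inner_closed[of "P k m", OF _ this] obtain T where
      T: "closed T" "T \<subseteq> P k m" "P k m - T \<in> lmeasurable" "emeasure lebesgue (P k m - T) < emeasure lebesgue (P k m)"
      unfolding fin by auto
    have cT: "compact T"
      using T bP by (meson bounded_subset compact_eq_bounded_closed)
    have "emeasure lebesgue T \<noteq> 0"
    proof
      assume 0: "emeasure lebesgue T = 0"
      have "emeasure lebesgue (P k m) \<le> emeasure lebesgue (T \<union> (P k m - T))"
        using T by (intro emeasure_mono) (auto simp: borel_closed)
      also have "\<dots> \<le> emeasure lebesgue T + emeasure lebesgue (P k m - T)"
        using T by (intro emeasure_subadditive) (auto simp: borel_closed)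
      finally show False using T(4) 0 by simp
    qed
    then have mT: "measure lborel T > 0"
      using emeasure_compact_finite[OF cT] T(1)
      by (simp add: measure_def enn2real_positive_iff zero_less_iff_neq_zero)
    have [measurable]: "T \<in> sets borel" using T by auto
    have "inverse (Suc k) * measure lborel T = (\<integral>x. indicator T x * inverse (real (Suc k)) \<partial>lborel)"
      by simp
    also have "\<dots> \<le> (\<integral>x. indicator T x * h x \<partial>lborel)"
    proof (rule integral_mono)
      show "integrable lborel (\<lambda>x. indicator T x * inverse (real (Suc k)))"
        using emeasure_compact_finite[OF cT] by (intro integrable_mult_left integrable_real_indicator) (auto simp: less_top[symmetric])
    qed (use T in \<open>auto simp: int cT P_def split: split_indicator intro: less_imp_le\<close>)
    also have "\<dots> \<le> 0" using nonpos[OF cT] .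
    finally show False using mT by (simp add: mult_le_0_iff)
  qed
  then have N: "(\<Union>k. \<Union>m. P k m) \<in> null_sets lborel"
    by (intro null_sets_UN)
  show ?thesis
  proof (rule AE_I'[OF N], safe)
    fix x assume "\<not> h x \<le> 0"
    then obtain k where "inverse (real (Suc k)) < h x" using reals_Archimedean[of "h x"] by auto
    moreover obtain m where "norm x \<le> real m" using real_arch_simple by blast
    ultimately show "x \<in> (\<Union>k. \<Union>m. P k m)" by (auto simp: P_def)
  qed
qed

text \<open>A point outside the compact set \<open>K\<close> has positive distance from \<open>K\<close>, so the indicators of the
differences converge to zero everywhere and dominated convergence applies.\<close>

lemma tendsto_measure_translate_minus:
  fixes K :: "'a::euclidean_space set"
  assumes K: "compact K" and c: "c \<longlonglongrightarrow> 0"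
  shows "(\<lambda>n. measure lborel ((+) (c n) ` K - K)) \<longlonglongrightarrow> 0"
proof -
  have A: "compact ((+) (c n) ` K)" for n using K compact_translation by auto
  have [measurable]: "(+) (c n) ` K \<in> sets borel" "K \<in> sets borel" for n
    using A[of n] K by (auto intro: borel_compact)
  obtain R where R: "\<And>x. x \<in> K \<Longrightarrow> norm x \<le> R"
    using K compact_imp_bounded bounded_iff by metis
  obtain B where B: "\<And>n. norm (c n) \<le> B"
    using c by (metis convergent_imp_Bseq convergentI BseqE)
  have "(\<lambda>n. \<integral>x. indicator ((+) (c n) ` K - K) x \<partial>lborel) \<longlonglongrightarrow> (\<integral>x. 0 \<partial>(lborel :: 'a measure) :: real)"
  proof (rule integral_dominated_convergence[where w="indicator (cball 0 (B + R))"])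
    show "AE x in lborel. (\<lambda>n. indicator ((+) (c n) ` K - K) x) \<longlonglongrightarrow> (0::real)"
    proof (rule AE_I2)
      fix x
      have "\<forall>\<^sub>F n in sequentially. indicator ((+) (c n) ` K - K) x = (0::real)"
      proof (cases "x \<in> K")
        case False
        then obtain e where e: "e > 0" "ball x e \<inter> K = {}"
          using compact_imp_closed[OF K] by (metis open_Compl closed_def openE Compl_iff disjoint_eq_subset_Compl)
        have "\<forall>\<^sub>F n in sequentially. norm (c n) < e"
          using c e(1) by (metis order_tendstoD(2) tendsto_norm_zero)
        then show ?thesis
        proof eventually_elim
          case (elim n)
          have "x \<notin> (+) (c n) ` K"
          proof
            assume "x \<in> (+) (c n) ` K"
            then obtain k where "k \<in> K" "x = c n + k" by auto
            with elim e show False by (auto simp: dist_norm disjoint_iff)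
          qed
          then show ?case by simp
        qed
      qed simp
      then show "(\<lambda>n. indicator ((+) (c n) ` K - K) x) \<longlonglongrightarrow> (0::real)"
        by (rule tendsto_eventually)
    qed
    show "integrable lborel (indicator (cball 0 (B + R)) :: 'a \<Rightarrow> real)"
      using emeasure_compact_finite[of "cball (0::'a) (B + R)"] by (intro integrable_real_indicator) (auto simp: less_top[symmetric])
    show "AE x in lborel. norm (indicator ((+) (c n) ` K - K) x :: real) \<le> indicator (cball 0 (B + R)) x" for n
    proof (rule AE_I2)
      fix x
      have "norm (c n + k) \<le> B + R" if "k \<in> K" for k
        using R[OF that] B[of n] norm_triangle_ineq[of "c n" k] by linarith
      then show "norm (indicator ((+) (c n) ` K - K) x :: real) \<le> indicator (cball 0 (B + R)) x"
        by (auto split: split_indicator)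
    qed
  qed auto
  then show ?thesis by simp
qed

text \<open>After a change of variables only the symmetric difference of \<open>K\<close> and its translate
contributes, and its two halves have equal measure.\<close>

lemma integral_translate_diff_le:
  fixes F :: "'a::euclidean_space \<Rightarrow> real"
  assumes K: "compact K" and F[measurable]: "F \<in> borel_measurable borel" and M: "\<And>x. \<bar>F x\<bar> \<le> M"
  shows "\<bar>\<integral>x. indicator K x * (F (a + x) - F x) \<partial>lborel\<bar> \<le> 2 * M * measure lborel ((+) a ` K - K)"
proof -
  define A where "A = (+) a ` K"
  have A: "compact A" unfolding A_def using K compact_translation by auto
  have [measurable]: "A \<in> sets borel" "K \<in> sets borel"
    using A K by (auto intro: borel_compact)
  have fin: "emeasure lborel A < \<infinity>" "emeasure lborel K < \<infinity>"
    by (rule emeasure_compact_finite, fact)+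
  have fm: "A \<in> fmeasurable lborel" "K \<in> fmeasurable lborel"
    using fin by (auto simp: fmeasurable_def)
  have int: "integrable lborel (\<lambda>x. indicator S x * G x)"
    if "S \<in> fmeasurable lborel" "G \<in> borel_measurable borel" "\<And>x. \<bar>G x\<bar> \<le> C" for S and G :: "'a \<Rightarrow> real" and C
  proof (rule Bochner_Integration.integrable_bound[of _ "\<lambda>x. C * indicator S x"])
    show "integrable lborel (\<lambda>x. C * indicator S x)"
      using that(1) by (intro integrable_mult_right integrable_real_indicator) (auto simp: fmeasurable_def)
    show "(\<lambda>x. indicator S x * G x) \<in> borel_measurable lborel"
      using that(2) fmeasurableD[OF that(1)] by (intro borel_measurable_times borel_measurable_indicator) auto
    show "AE x in lborel. norm (indicator S x * G x) \<le> norm (C * indicator S x)"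
    proof (rule AE_I2)
      fix x
      have "\<bar>G x\<bar> \<le> \<bar>C\<bar>" using that(3)[of x] by linarith
      then show "norm (indicator S x * G x) \<le> norm (C * indicator S x)"
        by (simp split: split_indicator)
    qed
  qed
  have tr: "(\<integral>x. indicator K x * F (a + x) \<partial>lborel) = (\<integral>x. indicator A x * F x \<partial>lborel)"
  proof -
    have "(\<integral>x. indicator A x * F x \<partial>lborel) = (\<integral>x. indicator A x * F x \<partial>distr lborel borel ((+) a))"
      by (simp add: lborel_distr_plus)
    also have "\<dots> = (\<integral>x. indicator A (a + x) * F (a + x) \<partial>lborel)"
      by (intro integral_distr) measurable
    also have "(\<lambda>x. indicator A (a + x) * F (a + x)) = (\<lambda>x. indicator K x * F (a + x))"
      by (auto simp: fun_eq_iff A_def split: split_indicator)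
    finally show ?thesis by simp
  qed
  have "(\<integral>x. indicator K x * (F (a + x) - F x) \<partial>lborel) =
      (\<integral>x. indicator K x * F (a + x) \<partial>lborel) - (\<integral>x. indicator K x * F x \<partial>lborel)"
    unfolding right_diff_distrib
    by (rule Bochner_Integration.integral_diff; rule int[where C=M]) (use fm M in auto)
  also have "\<dots> = (\<integral>x. indicator A x * F x - indicator K x * F x \<partial>lborel)"
    unfolding tr by (rule Bochner_Integration.integral_diff[symmetric]; rule int[where C=M]) (use fm M in auto)
  finally have eq: "(\<integral>x. indicator K x * (F (a + x) - F x) \<partial>lborel) = (\<integral>x. indicator A x * F x - indicator K x * F x \<partial>lborel)" .
  have fd: "A - K \<in> fmeasurable lborel" "K - A \<in> fmeasurable lborel" "A \<inter> K \<in> fmeasurable lborel"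
    using fm by (auto intro: fmeasurable_Diff fmeasurable_Int_fmeasurable)
  have mAK: "measure lborel A = measure lborel K"
    unfolding A_def using measure_translation[of a K] by (simp add: A_def[symmetric])
  have "measure lborel A = measure lborel (A \<inter> K) + measure lborel (A - K)"
    using fd by (subst measure_Union[symmetric]) (auto simp: Int_Diff_Un fmeasurable_def)
  moreover have "measure lborel K = measure lborel (A \<inter> K) + measure lborel (K - A)"
    using fd by (subst measure_Union[symmetric])
      (auto simp: fmeasurable_def intro!: arg_cong[where f="measure lborel"])
  ultimately have sym: "measure lborel (K - A) = measure lborel (A - K)" using mAK by simp
  have "\<bar>\<integral>x. indicator A x * F x - indicator K x * F x \<partial>lborel\<bar> \<le>
      (\<integral>x. M * indicator (A - K) x + M * indicator (K - A) x \<partial>lborel)"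
  proof (rule integral_abs_bound_integral)
    show "integrable lborel (\<lambda>x. indicator A x * F x - indicator K x * F x)"
      by (intro Bochner_Integration.integrable_diff; rule int[where C=M]) (use fm M in auto)
    show "integrable lborel (\<lambda>x. M * indicator (A - K) x + M * indicator (K - A) x)"
      using fd by (intro Bochner_Integration.integrable_add integrable_mult_right integrable_real_indicator) (auto simp: fmeasurable_def)
    show "\<bar>indicator A x * F x - indicator K x * F x\<bar> \<le> M * indicator (A - K) x + M * indicator (K - A) x" for x
      using M[of x] by (cases "x \<in> A"; cases "x \<in> K") auto
  qed
  also have "\<dots> = M * measure lborel (A - K) + M * measure lborel (K - A)"
  proof -
    have i: "integrable lborel (\<lambda>x. M * indicator S x)" if "S \<in> fmeasurable lborel" for S :: "'a set"
      using that by (intro integrable_mult_right integrable_real_indicator) (auto simp: fmeasurable_def)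
    show ?thesis
      using Bochner_Integration.integral_add[OF i[OF fd(1)] i[OF fd(2)]] by simp
  qed
  finally show ?thesis
    unfolding eq sym A_def[symmetric] by simp
qed

text \<open>A limit along one sequence, so that the function is Borel measurable by construction; it has the
intended meaning wherever the two-sided limit exists.\<close>

definition directional_deriv :: "('a::euclidean_space \<Rightarrow> real) \<Rightarrow> 'a \<Rightarrow> 'a \<Rightarrow> real" where
  "directional_deriv f v x = lim (\<lambda>n. difference_quotient f v x (inverse (real (Suc n))))"

lemma borel_measurable_difference_quotient:
  fixes f :: "'a::euclidean_space \<Rightarrow> real"
  assumes "L-lipschitz_on UNIV f"
  shows "(\<lambda>x. difference_quotient f v x t) \<in> borel_measurable borel"
  using continuous_on_difference_quotient[OF lipschitz_on_continuous_on[OF assms]]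
  by (rule borel_measurable_continuous_onI)

lemma borel_measurable_directional_deriv:
  fixes f :: "'a::euclidean_space \<Rightarrow> real"
  assumes "L-lipschitz_on UNIV f"
  shows "directional_deriv f v \<in> borel_measurable borel"
  unfolding directional_deriv_def[abs_def]
  by (intro borel_measurable_lim_metric borel_measurable_difference_quotient[OF assms])

lemma difference_quotient_LIMSEQ:
  assumes "(difference_quotient f v x \<longlongrightarrow> D) (at 0)"
  shows "(\<lambda>n. difference_quotient f v x (inverse (real (Suc n)))) \<longlonglongrightarrow> D"
proof (rule filterlim_compose[OF assms])
  show "filterlim (\<lambda>n. inverse (real (Suc n))) (at 0) sequentially"
    using LIMSEQ_inverse_real_of_nat by (auto simp: filterlim_at simp del: of_nat_Suc)
qed

lemma directional_deriv_eq:
  assumes "(difference_quotient f v x \<longlongrightarrow> D) (at 0)"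
  shows "directional_deriv f v x = D"
  unfolding directional_deriv_def using difference_quotient_LIMSEQ[OF assms] by (rule limI)

lemma AE_tendsto_directional_deriv:
  fixes f :: "'a::euclidean_space \<Rightarrow> real"
  assumes "L-lipschitz_on UNIV f"
  shows "AE x in lborel. (difference_quotient f v x \<longlongrightarrow> directional_deriv f v x) (at 0)"
  using AE_difference_quotient_convergent[OF assms, of v] by eventually_elim (metis directional_deriv_eq)

text \<open>Along \<open>t = 1 / (n + 1)\<close> the defect of additivity of the difference quotients at \<open>x\<close> is the
increment of the bounded quotient in direction \<open>w\<close> between \<open>x\<close> and \<open>x + t *\<^sub>R v\<close>. Integrated over
a compact set, this increment vanishes in the limit because translations by small vectors hardly
move the set.\<close>

lemma integral_directional_deriv_additive:
  fixes f :: "'a::euclidean_space \<Rightarrow> real" and v w :: 'a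
  assumes lip: "L-lipschitz_on UNIV f" and K: "compact K"
  defines "h \<equiv> \<lambda>x. directional_deriv f (v + w) x - directional_deriv f v x - directional_deriv f w x"
  shows "integrable lborel (\<lambda>x. indicator K x * h x)" (is ?int)
    and "(\<integral>x. indicator K x * h x \<partial>lborel) = 0" (is ?zero)
proof -
  define t where "t = (\<lambda>n::nat. inverse (real (Suc n)))"
  have t0: "t n \<noteq> 0" for n by (simp add: t_def)
  define Q where "Q = (\<lambda>n v x. difference_quotient f v x (t n))"
  define H where "H = (\<lambda>n x. Q n (v + w) x - Q n v x - Q n w x)"
  have Q[measurable]: "Q n v \<in> borel_measurable borel" for n v
    unfolding Q_def using lip by (rule borel_measurable_difference_quotient)
  have Qb: "\<bar>Q n v x\<bar> \<le> L * norm v" for n v x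
    unfolding Q_def using lip by (rule abs_difference_quotient_le)
  have [measurable]: "H n \<in> borel_measurable borel" for n unfolding H_def by measurable
  have [measurable]: "h \<in> borel_measurable borel"
    unfolding h_def using borel_measurable_directional_deriv[OF lip] by measurable
  have [measurable]: "K \<in> sets borel" using K by (rule borel_compact)
  have AEH: "AE x in lborel. (\<lambda>n. indicator K x * H n x) \<longlonglongrightarrow> indicator K x * h x"
    using AE_tendsto_directional_deriv[OF lip, of "v + w"] AE_tendsto_directional_deriv[OF lip, of v] AE_tendsto_directional_deriv[OF lip, of w]
  proof eventually_elim
    case (elim x)
    show ?case
      unfolding H_def h_def Q_def t_def
      by (intro tendsto_intros difference_quotient_LIMSEQ elim)
  qed
  let ?w = "\<lambda>x. (L * norm (v + w) + L * norm v + L * norm w) * indicator K x"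
  have w: "integrable lborel ?w"
    using emeasure_compact_finite[OF K]
    by (intro integrable_mult_right integrable_real_indicator) auto
  have dom: "AE x in lborel. norm (indicator K x * H n x) \<le> ?w x" for n
  proof (rule AE_I2)
    fix x
    show "norm (indicator K x * H n x) \<le> ?w x"
      using Qb[of n "v + w" x] Qb[of n v x] Qb[of n w x]
      by (cases "x \<in> K") (auto simp: H_def)
  qed
  show ?int
    by (rule integrable_dominated_convergence[OF _ _ w AEH dom]) measurable
  have lim: "(\<lambda>n. \<integral>x. indicator K x * H n x \<partial>lborel) \<longlonglongrightarrow> (\<integral>x. indicator K x * h x \<partial>lborel)"
    by (rule integral_dominated_convergence[OF _ _ w AEH dom]) measurable
  have "H n x = Q n w (t n *\<^sub>R v + x) - Q n w x" for n x
    using t0[of n] unfolding H_def Q_def difference_quotient_def by (simp add: field_simps scaleR_add_right)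
  then have bound: "norm (\<integral>x. indicator K x * H n x \<partial>lborel) \<le> 2 * (L * norm w) * measure lborel ((+) (t n *\<^sub>R v) ` K - K)" for n
    using integral_translate_diff_le[OF K Q Qb] by simp
  have vanish: "(\<lambda>n. 2 * (L * norm w) * measure lborel ((+) (t n *\<^sub>R v) ` K - K)) \<longlonglongrightarrow> 0"
  proof -
    have "(\<lambda>n. t n *\<^sub>R v) \<longlonglongrightarrow> 0 *\<^sub>R v"
      unfolding t_def by (intro tendsto_intros LIMSEQ_inverse_real_of_nat)
    then have "(\<lambda>n. measure lborel ((+) (t n *\<^sub>R v) ` K - K)) \<longlonglongrightarrow> 0"
      by (intro tendsto_measure_translate_minus[OF K]) simp
    then show ?thesis by (rule tendsto_mult_right_zero)
  qed
  have "(\<lambda>n. \<integral>x. indicator K x * H n x \<partial>lborel) \<longlonglongrightarrow> 0"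
    by (rule Lim_null_comparison[OF always_eventually vanish]) (rule allI, rule bound)
  with lim show ?zero
    by (rule LIMSEQ_unique)
qed

lemma AE_directional_deriv_additive:
  fixes f :: "'a::euclidean_space \<Rightarrow> real"
  assumes lip: "L-lipschitz_on UNIV f"
  shows "AE x in lborel. directional_deriv f (v + w) x = directional_deriv f v x + directional_deriv f w x"
proof -
  let ?h = "\<lambda>x. directional_deriv f (v + w) x - directional_deriv f v x - directional_deriv f w x"
  note m[measurable] = borel_measurable_directional_deriv[OF lip]
  have "AE x in lborel. ?h x \<le> 0"
    by (rule AE_nonpos_of_compact_integrals)
      (use integral_directional_deriv_additive[OF lip] in auto)
  moreover have "AE x in lborel. - ?h x \<le> 0"
  proof (rule AE_nonpos_of_compact_integrals)
    fix K :: "'a set" assume K: "compact K"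
    have eq: "(\<lambda>x. indicator K x * - ?h x) = (\<lambda>x. - (indicator K x * ?h x))"
      by (simp only: mult_minus_right)
    show "integrable lborel (\<lambda>x. indicator K x * - ?h x)"
      "(\<integral>x. indicator K x * - ?h x \<partial>lborel) \<le> 0"
      unfolding eq using integral_directional_deriv_additive[OF lip K, of v w] by auto
  qed measurable
  ultimately show ?thesis by eventually_elim auto
qed

lemma difference_quotient_scaleR_tendsto:
  assumes "(difference_quotient f v x \<longlongrightarrow> D) (at 0)"
  shows "(difference_quotient f (c *\<^sub>R v) x \<longlongrightarrow> c * D) (at 0)"
proof (cases "c = 0")
  case True
  then show ?thesis by (simp add: difference_quotient_def[abs_def])
next
  case False
  have "filterlim (\<lambda>t. t * c) (at 0) (at 0)"
    using False by (auto simp: filterlim_at eventually_at_filter intro!: tendsto_eq_intros)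
  from tendsto_mult_left[OF filterlim_compose[OF assms this], of c]
  have "((\<lambda>t. c * difference_quotient f v x (t * c)) \<longlongrightarrow> c * D) (at 0)" .
  moreover have "(\<lambda>t. c * difference_quotient f v x (t * c)) = difference_quotient f (c *\<^sub>R v) x"
    using False by (auto simp: difference_quotient_def fun_eq_iff)
  ultimately show ?thesis by simp
qed

section \<open>Rademacher's theorem\<close>

lemma AE_directional_deriv_linear:
  fixes f :: "'a::euclidean_space \<Rightarrow> real"
  assumes lip: "L-lipschitz_on UNIV f"
  shows "AE x in lborel. (difference_quotient f v x \<longlongrightarrow> v \<bullet> (\<Sum>b\<in>Basis. directional_deriv f b x *\<^sub>R b)) (at 0)"
proof -
  have "AE x in lborel. directional_deriv f (\<Sum>b\<in>B. (v \<bullet> b) *\<^sub>R b) x = (\<Sum>b\<in>B. (v \<bullet> b) * directional_deriv f b x)"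
    if "finite B" for B
    using that
  proof (induction B)
    case empty
    have "(difference_quotient f 0 x \<longlongrightarrow> 0) (at 0)" for x
      by (simp add: difference_quotient_def[abs_def])
    then show ?case by (simp add: directional_deriv_eq)
  next
    case (insert b B)
    have "AE x in lborel. directional_deriv f ((v \<bullet> b) *\<^sub>R b) x = (v \<bullet> b) * directional_deriv f b x"
      using AE_tendsto_directional_deriv[OF lip, of b]
      by eventually_elim (metis directional_deriv_eq difference_quotient_scaleR_tendsto)
    with insert.IH AE_directional_deriv_additive[OF lip, of "(v \<bullet> b) *\<^sub>R b" "\<Sum>b\<in>B. (v \<bullet> b) *\<^sub>R b"]
    show ?case
      by eventually_elim (simp add: insert.hyps)
  qed
  from this[OF finite_Basis] AE_tendsto_directional_deriv[OF lip, of v]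
  show ?thesis
    by eventually_elim (simp add: euclidean_representation inner_sum_right mult.commute)
qed

text \<open>Finitely many directions of a dense set approximate all unit vectors, and the Lipschitz bound
transfers the expansion from these directions to all others, uniformly.\<close>

lemma has_derivative_of_dense_directions:
  fixes f :: "'a::euclidean_space \<Rightarrow> real"
  assumes lip: "L-lipschitz_on UNIV f"
    and dense: "\<And>X. open X \<Longrightarrow> X \<noteq> {} \<Longrightarrow> \<exists>v\<in>V. v \<in> X"
    and dir: "\<And>v. v \<in> V \<Longrightarrow> (difference_quotient f v x \<longlongrightarrow> v \<bullet> g) (at 0)"
  shows "(f has_derivative (\<lambda>h. h \<bullet> g)) (at x)"
  unfolding has_derivative_at_alt
proof (intro conjI allI impI)
  show "bounded_linear (\<lambda>h. h \<bullet> g)" by (rule bounded_linear_inner_left)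
  fix e :: real assume "e > 0"
  have L: "L \<ge> 0" using lip lipschitz_on_nonneg by blast
  define d where "d = e / (L + norm g + 1)"
  have "L + norm g + 1 > 0" using L norm_ge_zero[of g] by linarith
  then have d: "d > 0" "(L + norm g + 1) * d = e"
    using \<open>e > 0\<close> unfolding d_def by simp_all
  have "sphere (0::'a) 1 \<subseteq> (\<Union>v\<in>V. ball v d)"
  proof
    fix w :: 'a
    obtain v where "v \<in> V" "v \<in> ball w d"
      using dense[of "ball w d"] d(1) by auto
    then show "w \<in> (\<Union>v\<in>V. ball v d)" by (auto simp: dist_commute)
  qed
  then obtain W where W: "W \<subseteq> V" "finite W" "sphere (0::'a) 1 \<subseteq> (\<Union>v\<in>W. ball v d)"
    using compactE_image[of "sphere (0::'a) 1" V "\<lambda>v. ball v d"] by (metis compact_sphere open_ball)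
  have "\<forall>\<^sub>F t in at 0. \<forall>v\<in>W. \<bar>difference_quotient f v x t - v \<bullet> g\<bar> < d"
    using W(2)
  proof (rule eventually_ball_finite, safe)
    fix v assume "v \<in> W"
    then show "\<forall>\<^sub>F t in at 0. \<bar>difference_quotient f v x t - v \<bullet> g\<bar> < d"
      using tendstoD[OF dir d(1), of v] W(1) by (auto simp: dist_real_def)
  qed
  then obtain r where r: "r > 0"
    "\<And>t v. t \<noteq> 0 \<Longrightarrow> \<bar>t\<bar> < r \<Longrightarrow> v \<in> W \<Longrightarrow> \<bar>difference_quotient f v x t - v \<bullet> g\<bar> < d"
    unfolding eventually_at by (auto simp: dist_real_def)
  show "\<exists>r>0. \<forall>y. norm (y - x) < r \<longrightarrow> norm (f y - f x - (y - x) \<bullet> g) \<le> e * norm (y - x)"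
  proof (intro exI conjI allI impI)
    fix y assume y: "norm (y - x) < r"
    show "norm (f y - f x - (y - x) \<bullet> g) \<le> e * norm (y - x)"
    proof (cases "y = x")
      case False
      define t where "t = norm (y - x)"
      define w where "w = (y - x) /\<^sub>R t"
      have t: "t > 0" "t < r" using False y by (auto simp: t_def)
      have w: "norm w = 1" "y = x + t *\<^sub>R w" using t by (auto simp: w_def t_def)
      obtain v where v: "v \<in> W" "norm (w - v) < d"
        using W(3) w(1) by (force simp: dist_norm norm_minus_commute)
      have 1: "\<bar>f y - f (x + t *\<^sub>R v)\<bar> \<le> L * (t * d)"
      proof -
        have "\<bar>f y - f (x + t *\<^sub>R v)\<bar> \<le> L * norm (t *\<^sub>R (w - v))"
          using lipschitz_onD[OF lip, of y "x + t *\<^sub>R v"] w by (simp add: dist_norm algebra_simps)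
        also have "\<dots> \<le> L * (t * d)"
          using v t L by (intro mult_left_mono) auto
        finally show ?thesis .
      qed
      have 2: "\<bar>f (x + t *\<^sub>R v) - f x - t * (v \<bullet> g)\<bar> \<le> t * d"
      proof -
        have "f (x + t *\<^sub>R v) - f x - t * (v \<bullet> g) = t * (difference_quotient f v x t - v \<bullet> g)"
          using t by (simp add: difference_quotient_def field_simps)
        then show ?thesis
          using r(2)[of t v] t v by (simp add: abs_mult)
      qed
      have 3: "\<bar>t * (v \<bullet> g) - t * (w \<bullet> g)\<bar> \<le> t * (d * norm g)"
      proof -
        have "\<bar>(v - w) \<bullet> g\<bar> \<le> norm (v - w) * norm g" by (rule Cauchy_Schwarz_ineq2)
        also have "\<dots> \<le> d * norm g"
          using v by (intro mult_right_mono) (auto simp: norm_minus_commute)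
        finally have "t * \<bar>(v - w) \<bullet> g\<bar> \<le> t * (d * norm g)" using t by simp
        moreover have "\<bar>t * (v \<bullet> g) - t * (w \<bullet> g)\<bar> = t * \<bar>(v - w) \<bullet> g\<bar>"
          using t by (simp add: abs_mult inner_diff_left flip: right_diff_distrib)
        ultimately show ?thesis by simp
      qed
      have "(y - x) \<bullet> g = t * (w \<bullet> g)" using w by simp
      then have "\<bar>f y - f x - (y - x) \<bullet> g\<bar> \<le> L * (t * d) + t * d + t * (d * norm g)"
        using 1 2 3 by linarith
      also have "\<dots> = (L + norm g + 1) * d * t" by (simp add: algebra_simps)
      also have "\<dots> = e * norm (y - x)" unfolding d(2) t_def ..
      finally show ?thesis by simp
    qed simp
  qed (use r in auto)
qed

theorem rademacher:
  fixes f :: "'a::euclidean_space \<Rightarrow> 'b::euclidean_space"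
  assumes lip: "L-lipschitz_on UNIV f"
  shows "negligible {x. \<not> f differentiable (at x)}"
proof -
  have comp: "negligible {x. \<not> (\<lambda>y. f y \<bullet> i) differentiable (at x)}" if i: "i \<in> Basis" for i
  proof -
    have lipi: "L-lipschitz_on UNIV (\<lambda>y. f y \<bullet> i)"
    proof (rule lipschitz_onI)
      fix x y
      have "dist (f x \<bullet> i) (f y \<bullet> i) \<le> dist (f x) (f y)"
        using Basis_le_norm[OF i, of "f x - f y"] by (simp add: dist_norm inner_diff_left)
      also have "\<dots> \<le> L * dist x y" using lip by (rule lipschitz_onD) auto
      finally show "dist (f x \<bullet> i) (f y \<bullet> i) \<le> L * dist x y" .
    qed (use lip lipschitz_on_nonneg in blast)
    obtain V :: "'a set" where V: "countable V" "\<And>X. open X \<Longrightarrow> X \<noteq> {} \<Longrightarrow> \<exists>v\<in>V. v \<in> X"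
      using countable_dense_setE by blast
    have "AE x in lborel. \<forall>v\<in>V. (difference_quotient (\<lambda>y. f y \<bullet> i) v x \<longlongrightarrow>
        v \<bullet> (\<Sum>b\<in>Basis. directional_deriv (\<lambda>y. f y \<bullet> i) b x *\<^sub>R b)) (at 0)"
      using V(1) AE_directional_deriv_linear[OF lipi] by (simp add: AE_ball_countable)
    then have "AE x in lborel. (\<lambda>y. f y \<bullet> i) differentiable (at x)"
    proof eventually_elim
      case (elim x)
      then show ?case
        unfolding differentiable_def by (blast intro: has_derivative_of_dense_directions[OF lipi V(2)])
    qed
    then obtain N where N: "N \<in> null_sets lborel" "{x. \<not> (\<lambda>y. f y \<bullet> i) differentiable (at x)} \<subseteq> N"
      by (auto simp: eventually_ae_filter)
    have "negligible N"
      using N(1) by (simp add: negligible_iff_null_sets null_sets_completionI)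
    then show ?thesis
      using N(2) by (rule negligible_subset)
  qed
  have "{x. \<not> f differentiable (at x)} = (\<Union>i\<in>Basis. {x. \<not> (\<lambda>y. f y \<bullet> i) differentiable (at x)})"
    using differentiable_componentwise_within[of f _ UNIV] by auto
  then show ?thesis
    using comp by (auto intro!: negligible_Union)
qed

section \<open>Images of points with singular derivative\<close>

text \<open>A copy of a finite type carrying a well-order pulled back from the natural numbers. Sard's theorem
in the form \<open>baby_Sard\<close> concerns vectors indexed by well-ordered types.\<close>

typedef 'n ordered_copy = "UNIV :: 'n set"
  morphisms of_copy to_copy by simp

lemma UNIV_ordered_copy: "(UNIV :: 'n ordered_copy set) = range to_copy"
  by (metis UNIV_eq_I of_copy_inverse range_eqI)

instance ordered_copy :: (finite) finite
  by standard (simp add: UNIV_ordered_copy)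

instantiation ordered_copy :: (finite) wellorder
begin

definition less_eq_ordered_copy :: "'a ordered_copy \<Rightarrow> 'a ordered_copy \<Rightarrow> bool" where
  "x \<le> y \<longleftrightarrow> to_nat (of_copy x) \<le> to_nat (of_copy y)"

definition less_ordered_copy :: "'a ordered_copy \<Rightarrow> 'a ordered_copy \<Rightarrow> bool" where
  "x < y \<longleftrightarrow> to_nat (of_copy x) < to_nat (of_copy y)"

instance
proof
  fix x y z :: "'a ordered_copy"
  show "x < y \<longleftrightarrow> x \<le> y \<and> \<not> y \<le> x" "x \<le> x" "x \<le> y \<or> y \<le> x"
    by (auto simp: less_eq_ordered_copy_def less_ordered_copy_def)
  show "x \<le> z" if "x \<le> y" "y \<le> z"
    using that by (simp add: less_eq_ordered_copy_def)
  show "x = y" if "x \<le> y" "y \<le> x"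
    using that by (simp add: less_eq_ordered_copy_def flip: of_copy_inject)
  fix P :: "'a ordered_copy \<Rightarrow> bool"
  assume step: "\<And>x. (\<And>y. y < x \<Longrightarrow> P y) \<Longrightarrow> P x"
  show "P x"
  proof (induction "to_nat (of_copy x)" arbitrary: x rule: less_induct)
    case less
    show ?case by (rule step, rule less) (simp add: less_ordered_copy_def)
  qed
qed

end

text \<open>Sard's theorem for maps between spaces of equal dimension, transported to arbitrary finite
index types by relabelling coordinates.\<close>

lemma negligible_image_singular_derivative:
  fixes f :: "real^'n \<Rightarrow> real^'n"
  assumes der: "\<And>x. x \<in> S \<Longrightarrow> (f has_derivative f' x) (at x)"
    and sing: "\<And>x. x \<in> S \<Longrightarrow> \<not> inj (f' x)"
  shows "negligible (f ` S)"
proof -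
  define P where "P = (\<lambda>x::real^'n. \<chi> i. x $ of_copy i)"
  define R where "R = (\<lambda>y::real^'n ordered_copy. \<chi> i. y $ to_copy i)"
  have lin: "linear P" "linear R"
    by (auto simp: P_def R_def linear_iff vec_eq_iff)
  have PR: "P (R y) = y" "R (P x) = x" for x y
    by (auto simp: P_def R_def vec_eq_iff to_copy_inverse of_copy_inverse)
  have bl: "bounded_linear P" "bounded_linear R"
    using lin linear_conv_bounded_linear by auto
  have "negligible ((\<lambda>y. P (f (R y))) ` P ` S)"
  proof (rule baby_Sard)
    fix y assume "y \<in> P ` S"
    then obtain x where x: "x \<in> S" "y = P x" by auto
    have D: "((\<lambda>y. P (f (R y))) has_derivative (\<lambda>h. P (f' x (R h)))) (at y)"
    proof -
      have "(f has_derivative f' x) (at (R y))" using der[OF x(1)] by (simp add: x PR)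
      from has_derivative_compose[OF has_derivative_compose[OF bounded_linear_imp_has_derivative[OF bl(2)] this]
          bounded_linear_imp_has_derivative[OF bl(1)]]
      show ?thesis .
    qed
    then show "((\<lambda>y. P (f (R y))) has_derivative (\<lambda>h. P (f' (R y) (R h)))) (at y within P ` S)"
      using has_derivative_at_withinI by (fastforce simp: x PR)
    have l: "linear (\<lambda>h. P (f' x (R h)))" using D has_derivative_linear by blast
    have "\<not> inj (\<lambda>h. P (f' x (R h)))"
    proof
      assume inj: "inj (\<lambda>h. P (f' x (R h)))"
      have "inj (f' x)"
      proof (rule injI)
        fix a b assume "f' x a = f' x b"
        then have "P (f' x (R (P a))) = P (f' x (R (P b)))" by (simp add: PR)
        then have "P a = P b" using inj by (auto dest: injD)
        then show "a = b" using PR by metis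
      qed
      then show False using sing[OF x(1)] by simp
    qed
    then have "\<not> inj ((*v) (matrix (\<lambda>h. P (f' x (R h)))))"
      using l by simp
    then have "rank (matrix (\<lambda>h. P (f' x (R h)))) \<noteq> CARD('n ordered_copy)"
      using full_rank_injective by blast
    then show "rank (matrix (\<lambda>h. P (f' (R y) (R h)))) < CARD('n ordered_copy)"
      using rank_bound[of "matrix (\<lambda>h. P (f' x (R h)))"] by (simp add: x PR)
  qed simp
  then have "negligible (R ` ((\<lambda>y. P (f (R y))) ` P ` S))"
  proof (rule negligible_differentiable_image_negligible[rotated])
    show "R differentiable_on (\<lambda>y. P (f (R y))) ` P ` S"
      using bl(2) bounded_linear_imp_differentiable_on by blast
    have "bij (to_copy :: 'n \<Rightarrow> 'n ordered_copy)"
      by (metis bijI' of_copy_inverse to_copy_inverse UNIV_I)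
    then have "CARD('n ordered_copy) = CARD('n)"
      by (metis bij_betw_same_card)
    then show "DIM(real^'n ordered_copy) \<le> DIM(real^'n)" by simp
  qed
  then show ?thesis by (simp add: image_image PR)
qed

section \<open>Extension of Lipschitz functions\<close>

text \<open>McShane's extension is the largest \<open>L\<close>-Lipschitz function that agrees with \<open>f\<close> on \<open>S\<close>.\<close>

lemma lipschitz_extension_real:
  fixes f :: "'a::metric_space \<Rightarrow> real"
  assumes lip: "L-lipschitz_on S f"
  obtains g where "L-lipschitz_on UNIV g" "\<And>x. x \<in> S \<Longrightarrow> g x = f x"
proof (cases "S = {}")
  case True
  have "L-lipschitz_on UNIV (\<lambda>x::'a. 0::real)"
    using lip lipschitz_on_nonneg by (auto simp: lipschitz_on_def)
  then show ?thesis using that True by blast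
next
  case False
  have L: "L \<ge> 0" using lip lipschitz_on_nonneg by blast
  then obtain s0 where s0: "s0 \<in> S" using False by blast
  define g where "g = (\<lambda>x. INF s\<in>S. f s + L * dist x s)"
  have tri: "f s \<le> f s' + L * dist s' s" if "s \<in> S" "s' \<in> S" for s s'
    using lipschitz_onD[OF lip that] by (simp add: dist_real_def dist_commute abs_le_iff)
  have bdd: "bdd_below ((\<lambda>s. f s + L * dist x s) ` S)" for x
  proof (rule bdd_belowI2)
    fix s assume s: "s \<in> S"
    have "L * dist s s0 \<le> L * dist x s + L * dist x s0"
      using L dist_triangle3[of s s0 x] by (simp add: mult_left_mono flip: distrib_left)
    then show "f s0 - L * dist x s0 \<le> f s + L * dist x s"
      using tri[OF s0 s] by simp
  qed
  have step: "g x \<le> g y + L * dist x y" for x y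
  proof -
    have "g x - L * dist x y \<le> f s + L * dist y s" if "s \<in> S" for s
    proof -
      have "g x \<le> f s + L * dist x s"
        unfolding g_def using bdd that by (rule cINF_lower)
      also have "L * dist x s \<le> L * dist x y + L * dist y s"
        using L dist_triangle[of x s y] by (simp add: mult_left_mono flip: distrib_left)
      finally show ?thesis by simp
    qed
    then have "g x - L * dist x y \<le> (INF s\<in>S. f s + L * dist y s)"
      using False by (intro cINF_greatest)
    also have "\<dots> = g y" by (simp only: g_def)
    finally show ?thesis by simp
  qed
  have "L-lipschitz_on UNIV g"
  proof (rule lipschitz_onI)
    fix x y show "dist (g x) (g y) \<le> L * dist x y"
      using step[of x y] step[of y x] by (simp add: dist_real_def dist_commute abs_le_iff)
  qed (rule L)
  moreover have "g x = f x" if "x \<in> S" for x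
  proof (rule antisym)
    show "g x \<le> f x"
      using cINF_lower[OF bdd that, of x] by (simp add: g_def)
    show "f x \<le> g x"
      unfolding g_def using False tri[OF that] by (intro cINF_greatest) (auto simp: dist_commute)
  qed
  ultimately show ?thesis using that by blast
qed

lemma lipschitz_extension:
  fixes f :: "'a::metric_space \<Rightarrow> 'b::euclidean_space"
  assumes lip: "L-lipschitz_on S f"
  obtains M g where "M-lipschitz_on UNIV g" "\<And>x. x \<in> S \<Longrightarrow> g x = f x"
proof -
  have L: "L \<ge> 0" using lip lipschitz_on_nonneg by blast
  have "\<exists>h. L-lipschitz_on UNIV h \<and> (\<forall>x\<in>S. h x = f x \<bullet> i)" if i: "i \<in> Basis" for i
  proof -
    have "L-lipschitz_on S (\<lambda>x. f x \<bullet> i)"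
    proof (rule lipschitz_onI)
      fix x y assume xy: "x \<in> S" "y \<in> S"
      have "dist (f x \<bullet> i) (f y \<bullet> i) \<le> dist (f x) (f y)"
        using Basis_le_norm[OF i, of "f x - f y"] by (simp add: dist_norm inner_diff_left)
      also have "\<dots> \<le> L * dist x y" using lip xy by (rule lipschitz_onD)
      finally show "dist (f x \<bullet> i) (f y \<bullet> i) \<le> L * dist x y" .
    qed (rule L)
    then show ?thesis by (rule lipschitz_extension_real) auto
  qed
  then obtain h where h: "\<And>i. i \<in> Basis \<Longrightarrow> L-lipschitz_on UNIV (h i)"
    "\<And>i x. i \<in> Basis \<Longrightarrow> x \<in> S \<Longrightarrow> h i x = f x \<bullet> i"
    by metis
  define g where "g = (\<lambda>x. \<Sum>i\<in>Basis. h i x *\<^sub>R i)"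
  have "(real DIM('b) * L)-lipschitz_on UNIV g"
  proof (rule lipschitz_onI)
    fix x y
    have "norm (g x - g y) \<le> (\<Sum>i\<in>Basis. \<bar>(g x - g y) \<bullet> i\<bar>)" by (rule norm_le_l1)
    also have "\<dots> \<le> (\<Sum>i\<in>(Basis :: 'b set). L * dist x y)"
      using lipschitz_onD[OF h(1), of _ x y]
      by (intro sum_mono) (simp add: g_def inner_diff_left dist_real_def)
    finally show "dist (g x) (g y) \<le> real DIM('b) * L * dist x y" by (simp add: dist_norm)
  qed (use L in simp)
  moreover have "g x = f x" if "x \<in> S" for x
    using h(2)[OF _ that] by (simp add: g_def euclidean_representation)
  ultimately show ?thesis using that by blast
qed

section \<open>Subgradients of convex functions\<close>

definition subdiff :: "'a::real_inner set \<Rightarrow> ('a \<Rightarrow> real) \<Rightarrow> 'a \<Rightarrow> 'a set" where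
  "subdiff C f x = {\<xi>. \<forall>y\<in>C. f x + \<xi> \<bullet> (y - x) \<le> f y}"

lemma subdiffD: "\<xi> \<in> subdiff C f x \<Longrightarrow> y \<in> C \<Longrightarrow> f x + \<xi> \<bullet> (y - x) \<le> f y"
  by (simp add: subdiff_def)

lemma convex_subdiff: "convex (subdiff C f x)"
  unfolding convex_def
proof (intro ballI allI impI)
  fix \<xi> \<eta> and a b :: real
  assume h: "\<xi> \<in> subdiff C f x" "\<eta> \<in> subdiff C f x" "0 \<le> a" "0 \<le> b" "a + b = 1"
  have "f x + (a *\<^sub>R \<xi> + b *\<^sub>R \<eta>) \<bullet> (y - x) \<le> f y" if "y \<in> C" for y
  proof -
    have "a * (f x + \<xi> \<bullet> (y - x)) + b * (f x + \<eta> \<bullet> (y - x)) \<le> a * f y + b * f y"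
      using h that by (intro add_mono mult_left_mono subdiffD) auto
    moreover have "a * f x + b * f x = f x" "a * f y + b * f y = f y"
      using h(5) by (simp_all flip: distrib_right)
    ultimately show ?thesis by (simp add: inner_add_left algebra_simps)
  qed
  then show "a *\<^sub>R \<xi> + b *\<^sub>R \<eta> \<in> subdiff C f x" by (simp add: subdiff_def)
qed

lemma subdiff_monotone:
  assumes "\<xi> \<in> subdiff C f x" "\<eta> \<in> subdiff C f y" "x \<in> C" "y \<in> C"
  shows "0 \<le> (\<xi> - \<eta>) \<bullet> (x - y)"
  using subdiffD[OF assms(1,4)] subdiffD[OF assms(2,3)]
  by (simp add: inner_diff_left inner_diff_right)

text \<open>A hyperplane separating the epigraph from the open vertical ray below \<open>(x, f x)\<close> cannot be
vertical, since \<open>x\<close> is interior; its slope is a subgradient.\<close>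

lemma subdiff_nonempty:
  fixes f :: "'a::euclidean_space \<Rightarrow> real"
  assumes f: "convex_on C f" and C: "open C" "x \<in> C"
  shows "subdiff C f x \<noteq> {}"
proof -
  define T where "T = {x} \<times> {..<f x}"
  have "convex (epigraph C f)" using f by (rule convex_epigraphI)
  moreover have "convex T" unfolding T_def by (intro convex_Times) auto
  moreover have "epigraph C f \<noteq> {}" using C by (auto simp: epigraph_def)
  moreover have "T \<noteq> {}"
    using lt_ex[of "f x"] by (auto simp: T_def)
  moreover have "epigraph C f \<inter> T = {}" by (auto simp: epigraph_def T_def)
  ultimately obtain a b where ab: "a \<noteq> 0" "\<And>z. z \<in> epigraph C f \<Longrightarrow> a \<bullet> z \<le> b" "\<And>z. z \<in> T \<Longrightarrow> b \<le> a \<bullet> z"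
    using separating_hyperplane_sets[of "epigraph C f" T] by blast
  obtain \<alpha> \<beta> where a: "a = (\<alpha>, \<beta>)" by (cases a)
  have key: "\<alpha> \<bullet> y + \<beta> * r \<le> \<alpha> \<bullet> x + \<beta> * s" if "y \<in> C" "f y \<le> r" "s < f x" for y r s
    using ab(2)[of "(y, r)"] ab(3)[of "(x, s)"] that by (auto simp: epigraph_def T_def a)
  \<comment> \<open>Let \<open>s\<close> increase to \<open>f x\<close>.\<close>
  have key': "\<alpha> \<bullet> y + \<beta> * f y \<le> \<alpha> \<bullet> x + \<beta> * f x" if "y \<in> C" for y
  proof (rule field_le_epsilon)
    fix e :: real assume "e > 0"
    define d where "d = e / (\<bar>\<beta>\<bar> + 1)"
    have d: "d > 0" "\<bar>\<beta>\<bar> * d \<le> e" using \<open>e > 0\<close> by (auto simp: d_def field_simps)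
    have "- \<beta> * d \<le> \<bar>\<beta>\<bar> * d" using d(1) by (intro mult_right_mono) auto
    then show "\<alpha> \<bullet> y + \<beta> * f y \<le> \<alpha> \<bullet> x + \<beta> * f x + e"
      using key[OF that order_refl, of "f x - d"] d by (simp add: right_diff_distrib)
  qed
  have "\<beta> \<le> 0" using key[OF C(2), of "f x" "f x - 1"] by (simp add: right_diff_distrib)
  moreover have "\<beta> \<noteq> 0"
  proof
    assume 0: "\<beta> = 0"
    obtain e where e: "e > 0" "ball x e \<subseteq> C" using C openE by blast
    have "\<alpha> \<noteq> 0" using ab(1) a 0 by (auto simp: zero_prod_def)
    define y where "y = x + (e / 2 / norm \<alpha>) *\<^sub>R \<alpha>"
    have "y \<in> C" using e \<open>\<alpha> \<noteq> 0\<close> by (intro subsetD[OF e(2)]) (auto simp: y_def dist_norm)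
    from key'[OF this] have "\<alpha> \<bullet> ((e / 2 / norm \<alpha>) *\<^sub>R \<alpha>) \<le> 0"
      by (simp add: 0 y_def inner_add_right)
    moreover have "\<alpha> \<bullet> ((e / 2 / norm \<alpha>) *\<^sub>R \<alpha>) > 0" using e \<open>\<alpha> \<noteq> 0\<close> by simp
    ultimately show False by simp
  qed
  ultimately have \<beta>: "\<beta> < 0" by simp
  have "(1 / - \<beta>) *\<^sub>R \<alpha> \<in> subdiff C f x"
    unfolding subdiff_def
  proof (intro CollectI ballI)
    fix y assume "y \<in> C"
    then have "(1 / - \<beta>) * (\<alpha> \<bullet> (y - x)) \<le> (1 / - \<beta>) * (- \<beta> * (f y - f x))"
      using key'[of y] \<beta> by (intro mult_left_mono) (auto simp: inner_diff_right algebra_simps)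
    then show "f x + ((1 / - \<beta>) *\<^sub>R \<alpha>) \<bullet> (y - x) \<le> f y" using \<beta> by simp
  qed
  then show ?thesis by blast
qed

text \<open>A subgradient of norm \<open>s\<close> at \<open>y\<close> forces \<open>f\<close> to grow by \<open>s * e / 2\<close> along a step of length
\<open>e / 2\<close>, while \<open>f\<close> is bounded on compact balls.\<close>

lemma subdiff_locally_bounded:
  fixes f :: "'a::euclidean_space \<Rightarrow> real"
  assumes f: "convex_on C f" and C: "open C" "x \<in> C"
  obtains r K where "r > 0" "\<And>y \<eta>. y \<in> ball x r \<Longrightarrow> \<eta> \<in> subdiff C f y \<Longrightarrow> norm \<eta> \<le> K"
proof -
  obtain e where e: "e > 0" "cball x e \<subseteq> C" using C open_contains_cball by blast
  have "continuous_on (cball x e) f"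
    using convex_on_continuous[OF C(1) f] e(2) continuous_on_subset by blast
  then have "bounded (f ` cball x e)"
    by (intro compact_imp_bounded compact_continuous_image) auto
  then obtain M where M: "\<And>y. y \<in> cball x e \<Longrightarrow> \<bar>f y\<bar> \<le> M"
    unfolding bounded_iff by (metis image_eqI real_norm_def)
  have "norm \<eta> \<le> 4 * M / e" if y: "y \<in> ball x (e / 2)" and \<eta>: "\<eta> \<in> subdiff C f y" for y \<eta>
  proof (cases "\<eta> = 0")
    case True
    have "0 \<le> M" using M[of x] e by auto
    then show ?thesis using True e by simp
  next
    case False
    define z where "z = y + (e / 2 / norm \<eta>) *\<^sub>R \<eta>"
    have "dist y z = e / 2" using False e by (simp add: z_def dist_norm)
    then have z: "z \<in> cball x e" using y dist_triangle[of x z y] by simp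
    have "f y + \<eta> \<bullet> (z - y) \<le> f z" using \<eta> z e by (intro subdiffD) auto
    moreover have "\<eta> \<bullet> (z - y) = e / 2 * norm \<eta>"
      using False by (simp add: z_def dot_square_norm power2_eq_square)
    moreover have "\<bar>f z\<bar> \<le> M" "\<bar>f y\<bar> \<le> M" using M z y e by auto
    ultimately have "e / 2 * norm \<eta> \<le> 2 * M" by linarith
    then show ?thesis using e by (simp add: field_simps)
  qed
  then show ?thesis using that[of "e / 2"] e by auto
qed

lemma subdiff_closed_graph:
  fixes f :: "'a::euclidean_space \<Rightarrow> real"
  assumes f: "convex_on C f" and C: "open C" "x \<in> C"
    and lim: "X \<longlonglongrightarrow> x" "Y \<longlonglongrightarrow> \<eta>" and Y: "\<And>n. Y n \<in> subdiff C f (X n)"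
  shows "\<eta> \<in> subdiff C f x"
  unfolding subdiff_def
proof (intro CollectI ballI)
  fix y assume y: "y \<in> C"
  have "isCont f x"
    using convex_on_continuous[OF C(1) f] C by (simp add: continuous_on_eq_continuous_at)
  then have "(\<lambda>n. f (X n)) \<longlonglongrightarrow> f x" using lim(1) isCont_tendsto_compose by blast
  then have "(\<lambda>n. f (X n) + Y n \<bullet> (y - X n)) \<longlonglongrightarrow> f x + \<eta> \<bullet> (y - x)"
    by (intro tendsto_intros lim)
  then show "f x + \<eta> \<bullet> (y - x) \<le> f y"
    by (rule LIMSEQ_le_const2) (use subdiffD[OF Y y] in auto)
qed

text \<open>Here \<open>J\<close> inverts the map \<open>x + \<xi> \<mapsto> x\<close> on the graph of the subdifferential and is differentiable
with an injective, hence bijective, derivative. If \<open>f\<close> had a second subgradient at \<open>x\<close>, then \<open>J\<close>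
would be constant on a segment starting at \<open>x + \<xi>\<close>, which injectivity forbids. Uniqueness together
with the closed graph makes subgradients at nearby points close to \<open>\<xi>\<close>, so the differentiability of
\<open>J\<close> can be used at \<open>y + \<eta>\<close>; inverting the resulting expansion gives a first order expansion of
the subdifferential.\<close>

lemma subdiff_has_derivative:
  fixes f :: "'a::euclidean_space \<Rightarrow> real"
  assumes f: "convex_on C f" and C: "open C" "x \<in> C"
    and \<xi>: "\<xi> \<in> subdiff C f x"
    and J: "\<And>y \<eta>. y \<in> C \<Longrightarrow> \<eta> \<in> subdiff C f y \<Longrightarrow> J (y + \<eta>) = y"
    and der: "(J has_derivative D) (at (x + \<xi>))" and inj: "inj D"
  obtains M where "linear M"
    "\<And>e. e > 0 \<Longrightarrow> \<exists>d>0. \<forall>y\<in>C. norm (y - x) < d \<longrightarrow>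
        (\<forall>\<eta>\<in>subdiff C f y. norm (\<eta> - \<xi> - M (y - x)) \<le> e * norm (y - x))"
proof -
  have linD: "linear D" using der has_derivative_linear by blast
  obtain T where T: "linear T" "\<And>h. T (D h) = h" "\<And>h. D (T h) = h"
    using linear_injective_isomorphism[OF linD inj] by blast
  obtain B where B: "B > 0" "\<And>h. norm (T h) \<le> B * norm h"
    using linear_bounded_pos[OF T(1)] by blast
  have der_bound: "\<exists>d>0. \<forall>z. norm (z - (x + \<xi>)) < d \<longrightarrow>
      norm (J z - J (x + \<xi>) - D (z - (x + \<xi>))) \<le> e * norm (z - (x + \<xi>))" if "e > 0" for e
    using der that unfolding has_derivative_at_alt by blast
  have single: "\<eta> = \<xi>" if \<eta>: "\<eta> \<in> subdiff C f x" for \<eta>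
  proof (rule ccontr)
    assume "\<eta> \<noteq> \<xi>"
    define v where "v = \<eta> - \<xi>"
    have v: "norm v > 0" using \<open>\<eta> \<noteq> \<xi>\<close> by (simp add: v_def)
    obtain d where d: "d > 0"
      "\<And>z. norm (z - (x + \<xi>)) < d \<Longrightarrow> norm (J z - J (x + \<xi>) - D (z - (x + \<xi>))) \<le> 1 / (2 * B) * norm (z - (x + \<xi>))"
      using der_bound[of "1 / (2 * B)"] B(1) by auto
    define t where "t = min 1 (d / 2 / norm v)"
    have t: "0 < t" "t \<le> 1" using d(1) v by (auto simp: t_def)
    have "t * norm v \<le> d / 2 / norm v * norm v" unfolding t_def using v by (intro mult_right_mono) auto
    then have tv: "t * norm v < d" using d(1) v by simp
    have mem: "(1 - t) *\<^sub>R \<xi> + t *\<^sub>R \<eta> \<in> subdiff C f x"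
      using convexD_alt[OF convex_subdiff \<xi> \<eta>, of t] t by simp
    have "x + \<xi> + t *\<^sub>R v = x + ((1 - t) *\<^sub>R \<xi> + t *\<^sub>R \<eta>)"
      by (simp add: v_def algebra_simps)
    then have "J (x + \<xi> + t *\<^sub>R v) = J (x + \<xi>)"
      using J[OF C(2) mem] J[OF C(2) \<xi>] by (simp only:)
    then have "norm (D (t *\<^sub>R v)) \<le> 1 / (2 * B) * (t * norm v)"
      using d(2)[of "x + \<xi> + t *\<^sub>R v"] tv t by simp
    then have "B * norm (D (t *\<^sub>R v)) \<le> B * (1 / (2 * B) * (t * norm v))"
      using B(1) by (intro mult_left_mono) auto
    moreover have "t * norm v \<le> B * norm (D (t *\<^sub>R v))"
      using B(2)[of "D (t *\<^sub>R v)"] t by (simp add: T(2))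
    ultimately have "t * norm v \<le> 1 / 2 * (t * norm v)" using B(1) by simp
    then show False using mult_pos_pos[OF t(1) v] by linarith
  qed
  have cont: "\<exists>d>0. \<forall>y\<in>C. norm (y - x) < d \<longrightarrow> (\<forall>\<eta>\<in>subdiff C f y. norm (\<eta> - \<xi>) < e)" if "e > 0" for e
  proof (rule ccontr)
    assume neg: "\<not> ?thesis"
    have "\<exists>y \<eta>. y \<in> C \<and> norm (y - x) < inverse (real (Suc n)) \<and> \<eta> \<in> subdiff C f y \<and> e \<le> norm (\<eta> - \<xi>)" for n
    proof -
      have "inverse (real (Suc n)) > 0" by simp
      then show ?thesis using neg not_le by blast
    qed
    then obtain X Y where XY: "\<And>n. X n \<in> C" "\<And>n. norm (X n - x) < inverse (real (Suc n))"
      "\<And>n. Y n \<in> subdiff C f (X n)" "\<And>n. e \<le> norm (Y n - \<xi>)"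
      by metis
    obtain r K where rK: "r > 0" "\<And>y \<eta>. y \<in> ball x r \<Longrightarrow> \<eta> \<in> subdiff C f y \<Longrightarrow> norm \<eta> \<le> K"
      using subdiff_locally_bounded[OF f C] by metis
    have Xlim: "X \<longlonglongrightarrow> x"
    proof -
      have "(\<lambda>n. X n - x) \<longlonglongrightarrow> 0"
        by (rule Lim_null_comparison[OF always_eventually LIMSEQ_inverse_real_of_nat])
          (use XY(2) less_imp_le in blast)
      then show ?thesis by (simp add: LIM_zero_iff)
    qed
    have "\<forall>\<^sub>F n in sequentially. dist (X n) x < r" using Xlim rK(1) tendstoD by blast
    then obtain N where N: "\<And>n. n \<ge> N \<Longrightarrow> dist (X n) x < r"
      by (auto simp: eventually_sequentially)
    have "Y (n + N) \<in> cball 0 K" for n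
      using rK(2)[OF _ XY(3)] N by (auto simp: dist_commute)
    then obtain \<eta> s where s: "strict_mono (s :: nat \<Rightarrow> nat)" "(\<lambda>n. Y (s n + N)) \<longlonglongrightarrow> \<eta>"
      using compact_cball[of "0::'a" K, unfolded compact_def, rule_format, of "\<lambda>n. Y (n + N)"]
      by (auto simp: comp_def)
    have "(\<lambda>n. X (s n + N)) \<longlonglongrightarrow> x"
      using LIMSEQ_subseq_LIMSEQ[OF LIMSEQ_ignore_initial_segment[OF Xlim, of N] s(1)] by (simp add: comp_def)
    then have "\<eta> \<in> subdiff C f x"
      using subdiff_closed_graph[OF f C _ s(2) XY(3)] by blast
    then have "\<eta> = \<xi>" by (rule single)
    moreover have "e \<le> norm (\<eta> - \<xi>)"
      by (rule LIMSEQ_le_const[OF tendsto_norm[OF tendsto_diff[OF s(2) tendsto_const]]]) (use XY(4) in blast)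
    ultimately show False using \<open>e > 0\<close> by simp
  qed
  \<comment> \<open>\<open>T\<close> is the derivative of the identity plus the subdifferential.\<close>
  define M where "M = (\<lambda>h. T h - h)"
  have "linear M" unfolding M_def using T(1) by (intro linear_compose_sub) (auto simp: linear_iff)
  moreover have "\<exists>d>0. \<forall>y\<in>C. norm (y - x) < d \<longrightarrow>
        (\<forall>\<eta>\<in>subdiff C f y. norm (\<eta> - \<xi> - M (y - x)) \<le> e * norm (y - x))" if "e > 0" for e
  proof -
    \<comment> \<open>The first bound absorbs the error into the left-hand side, giving
      \<open>norm k \<le> 2 * B * norm (y - x)\<close>; the second makes the final error small.\<close>
    define e1 where "e1 = min (1 / (2 * B)) (e / (2 * B\<^sup>2))"
    have e1: "e1 > 0" "B * e1 \<le> 1 / 2" "2 * B\<^sup>2 * e1 \<le> e"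
      using B(1) \<open>e > 0\<close> by (auto simp: e1_def min_def field_simps power2_eq_square)
    obtain d1 where d1: "d1 > 0"
      "\<And>z. norm (z - (x + \<xi>)) < d1 \<Longrightarrow> norm (J z - J (x + \<xi>) - D (z - (x + \<xi>))) \<le> e1 * norm (z - (x + \<xi>))"
      using der_bound[OF e1(1)] by blast
    obtain d2 where d2: "d2 > 0"
      "\<And>y \<eta>. y \<in> C \<Longrightarrow> norm (y - x) < d2 \<Longrightarrow> \<eta> \<in> subdiff C f y \<Longrightarrow> norm (\<eta> - \<xi>) < d1 / 2"
      using cont[of "d1 / 2"] d1(1) by auto
    have "norm (\<eta> - \<xi> - M (y - x)) \<le> e * norm (y - x)"
      if y: "y \<in> C" "norm (y - x) < min d2 (d1 / 2)" and \<eta>: "\<eta> \<in> subdiff C f y" for y \<eta>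
    proof -
      define k where "k = (y - x) + (\<eta> - \<xi>)"
      have k: "y + \<eta> - (x + \<xi>) = k" by (simp add: k_def)
      have "norm k < d1"
        using norm_triangle_ineq[of "y - x" "\<eta> - \<xi>"] d2(2)[OF y(1) _ \<eta>] y(2) by (simp add: k_def)
      then have "norm (y - x - D k) \<le> e1 * norm k"
        using d1(2)[of "y + \<eta>"] J y(1) \<eta> C(2) \<xi> by (simp add: k)
      then have "B * norm (y - x - D k) \<le> B * (e1 * norm k)" using B(1) by simp
      then have 1: "norm (T (y - x) - k) \<le> B * e1 * norm k"
        using B(2)[of "y - x - D k"] by (simp add: linear_diff[OF T(1)] T(2) mult.assoc)
      have "norm k \<le> norm (T (y - x)) + norm (T (y - x) - k)"
        by (metis norm_triangle_sub norm_minus_commute)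
      also have "\<dots> \<le> B * norm (y - x) + 1 / 2 * norm k"
        using B(2)[of "y - x"] 1 mult_right_mono[OF e1(2) norm_ge_zero[of k]] by linarith
      finally have "norm k \<le> 2 * B * norm (y - x)" by simp
      then have "B * e1 * norm k \<le> B * e1 * (2 * B * norm (y - x))"
        using B(1) e1(1) by (intro mult_left_mono) auto
      also have "\<dots> = (2 * B\<^sup>2 * e1) * norm (y - x)" by (simp add: power2_eq_square)
      also have "\<dots> \<le> e * norm (y - x)" using e1(3) by (rule mult_right_mono) simp
      finally have "norm (T (y - x) - k) \<le> e * norm (y - x)" using 1 by simp
      moreover have "\<eta> - \<xi> - M (y - x) = - (T (y - x) - k)" by (simp add: M_def k_def)
      ultimately show ?thesis by (simp only: norm_minus_cancel)
    qed
    then show ?thesis using d1(1) d2(1) by (intro exI[of _ "min d2 (d1 / 2)"]) auto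
  qed
  ultimately show ?thesis using that by blast
qed

section \<open>Alexandrov's theorem\<close>

text \<open>The first order expansion of subgradients is integrated along the segment from \<open>x\<close> to
\<open>x + h\<close>: on each of \<open>N\<close> equal pieces the increment of \<open>f\<close> lies between the slopes given by
subgradients at the two end points, and these Riemann sums converge as \<open>N\<close> grows.\<close>

lemma convex_second_order_expansion:
  fixes f :: "'a::euclidean_space \<Rightarrow> real"
  assumes f: "convex_on C f" and C: "open C" "x \<in> C"
    and M: "linear M"
    and der: "\<And>e. e > 0 \<Longrightarrow> \<exists>d>0. \<forall>y\<in>C. norm (y - x) < d \<longrightarrow>
        (\<forall>\<eta>\<in>subdiff C f y. norm (\<eta> - \<xi> - M (y - x)) \<le> e * norm (y - x))"
    and "e > 0"
  shows "\<exists>d>0. \<forall>h. norm h < d \<longrightarrow>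
    \<bar>f (x + h) - f x - \<xi> \<bullet> h - 1/2 * (M h \<bullet> h)\<bar> \<le> e * (norm h)\<^sup>2"
proof -
  obtain d1 where d1: "d1 > 0" "ball x d1 \<subseteq> C" using C openE by blast
  obtain d2 where d2: "d2 > 0" "\<And>y \<eta>. y \<in> C \<Longrightarrow> norm (y - x) < d2 \<Longrightarrow> \<eta> \<in> subdiff C f y \<Longrightarrow>
      norm (\<eta> - \<xi> - M (y - x)) \<le> e * norm (y - x)"
    using der[OF \<open>e > 0\<close>] by blast
  have "\<bar>f (x + h) - f x - \<xi> \<bullet> h - 1/2 * (M h \<bullet> h)\<bar> \<le> e * (norm h)\<^sup>2"
    if h: "norm h < min d1 d2" for h
  proof -
    define a where "a = M h \<bullet> h"
    define b where "b = e * (norm h)\<^sup>2"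
    have b: "b \<ge> 0" using \<open>e > 0\<close> by (simp add: b_def)
    define p where "p = (\<lambda>t. x + t *\<^sub>R h)"
    have pC: "p t \<in> C" "norm (p t - x) < d2" if "0 \<le> t" "t \<le> 1" for t
    proof -
      have "\<bar>t\<bar> * norm h \<le> 1 * norm h" using that by (intro mult_right_mono) auto
      then have "norm (t *\<^sub>R h) < min d1 d2" using h by simp
      then show "p t \<in> C" "norm (p t - x) < d2"
        using d1(2) by (auto simp: p_def dist_norm subset_eq)
    qed
    define g where "g = (\<lambda>t. SOME \<eta>. \<eta> \<in> subdiff C f (p t))"
    have g: "g t \<in> subdiff C f (p t)" if "0 \<le> t" "t \<le> 1" for t
      unfolding g_def using subdiff_nonempty[OF f C(1) pC(1)[OF that]] by (simp add: some_in_eq)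
    have slope: "\<bar>g t \<bullet> h - \<xi> \<bullet> h - t * a\<bar> \<le> t * b" if t: "0 \<le> t" "t \<le> 1" for t
    proof -
      have "norm (g t - \<xi> - M (p t - x)) \<le> e * norm (p t - x)"
        using d2(2)[OF pC[OF t] g[OF t]] .
      then have "norm (g t - \<xi> - t *\<^sub>R M h) * norm h \<le> (e * (t * norm h)) * norm h"
        using t by (intro mult_right_mono) (auto simp: p_def linear_scale[OF M])
      moreover have "\<bar>(g t - \<xi> - t *\<^sub>R M h) \<bullet> h\<bar> \<le> norm (g t - \<xi> - t *\<^sub>R M h) * norm h"
        by (rule Cauchy_Schwarz_ineq2)
      ultimately show ?thesis
        by (simp add: a_def b_def inner_diff_left power2_eq_square algebra_simps)
    qed
    have incr: "f (p t) - f (p s) \<le> (t - s) * (g t \<bullet> h)" "(t - s) * (g s \<bullet> h) \<le> f (p t) - f (p s)"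
      if "0 \<le> s" "s \<le> 1" "0 \<le> t" "t \<le> 1" for s t
      using subdiffD[OF g pC(1), of t s] subdiffD[OF g pC(1), of s t] that
      by (simp_all add: p_def algebra_simps inner_diff_right flip: scaleR_diff_left)
    have bound: "\<bar>f (x + h) - f x - \<xi> \<bullet> h - 1/2 * a\<bar> \<le> b + inverse (real (Suc n)) * (\<bar>a\<bar> + b)" for n
    proof -
      define N where "N = Suc n"
      have N: "N > 0" by (simp add: N_def)
      define t where "t = (\<lambda>i::nat. real i / real N)"
      have t: "0 \<le> t i" "t i \<le> 1" if "i \<le> N" for i using that N by (auto simp: t_def)
      have dt: "t (Suc i) - t i = 1 / N" for i using N by (simp add: t_def field_simps)
      have tel: "f (x + h) - f x = (\<Sum>i<N. f (p (t (Suc i))) - f (p (t i)))"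
        using N by (subst sum_lessThan_telescope) (simp add: p_def t_def)
      have up: "f (p (t (Suc i))) - f (p (t i)) \<le> 1 / N * (\<xi> \<bullet> h) + (real i + 1) * ((a + b) / N\<^sup>2)"
        if "i < N" for i
      proof -
        have "f (p (t (Suc i))) - f (p (t i)) \<le> 1 / N * (g (t (Suc i)) \<bullet> h)"
          using incr(1)[of "t i" "t (Suc i)"] t that by (simp add: dt)
        also have "\<dots> \<le> 1 / N * (\<xi> \<bullet> h + t (Suc i) * (a + b))"
          using slope[of "t (Suc i)"] t that N by (intro mult_left_mono) (auto simp: algebra_simps abs_le_iff)
        also have "\<dots> = 1 / N * (\<xi> \<bullet> h) + (real i + 1) * ((a + b) / N\<^sup>2)"
          using N by (simp add: t_def field_simps power2_eq_square)
        finally show ?thesis .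
      qed
      have lo: "1 / N * (\<xi> \<bullet> h) + real i * ((a - b) / N\<^sup>2) \<le> f (p (t (Suc i))) - f (p (t i))"
        if "i < N" for i
      proof -
        have "1 / N * (\<xi> \<bullet> h) + real i * ((a - b) / N\<^sup>2) = 1 / N * (\<xi> \<bullet> h + t i * (a - b))"
          using N by (simp add: t_def field_simps power2_eq_square)
        also have "\<dots> \<le> 1 / N * (g (t i) \<bullet> h)"
          using slope[of "t i"] t[of i] that N by (intro mult_left_mono) (auto simp: algebra_simps abs_le_iff)
        also have "\<dots> \<le> f (p (t (Suc i))) - f (p (t i))"
          using incr(2)[of "t i" "t (Suc i)"] t[of i] t[of "Suc i"] that by (simp add: dt)
        finally show ?thesis .
      qed
      define k where "k = real N"
      have k: "k \<noteq> 0" "inverse (real (Suc n)) = inverse k" using N by (simp_all add: k_def N_def)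
      have gauss: "(\<Sum>i<N. real i) = k * (k - 1) / 2"
        unfolding k_def N_def by (induction n) (auto simp: field_simps)
      have "f (x + h) - f x \<le> (\<Sum>i<N. 1 / N * (\<xi> \<bullet> h) + (real i + 1) * ((a + b) / N\<^sup>2))"
        unfolding tel by (intro sum_mono up) auto
      also have "\<dots> = \<xi> \<bullet> h + (k * (k - 1) / 2 + k) * ((a + b) / k\<^sup>2)"
        using k by (simp add: sum.distrib gauss flip: sum_distrib_right sum_divide_distrib k_def)
      also have "\<dots> = \<xi> \<bullet> h + (a + b) / 2 + inverse (real (Suc n)) * ((a + b) / 2)"
        unfolding k(2) using k(1) by (simp add: field_simps power2_eq_square)
      finally have 1: "f (x + h) - f x \<le> \<xi> \<bullet> h + (a + b) / 2 + inverse (real (Suc n)) * ((a + b) / 2)" .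
      have "\<xi> \<bullet> h + (a - b) / 2 - inverse (real (Suc n)) * ((a - b) / 2) = \<xi> \<bullet> h + (k * (k - 1) / 2) * ((a - b) / k\<^sup>2)"
        unfolding k(2) using k(1) by (simp add: field_simps power2_eq_square)
      also have "\<dots> = (\<Sum>i<N. 1 / N * (\<xi> \<bullet> h) + real i * ((a - b) / N\<^sup>2))"
        using k by (simp add: sum.distrib gauss flip: sum_distrib_right sum_divide_distrib k_def)
      also have "\<dots> \<le> f (x + h) - f x"
        unfolding tel by (intro sum_mono lo) auto
      finally have 2: "\<xi> \<bullet> h + (a - b) / 2 - inverse (real (Suc n)) * ((a - b) / 2) \<le> f (x + h) - f x" .
      have "(a + b) / 2 \<le> \<bar>a\<bar> + b" "(a - b) / 2 \<le> \<bar>a\<bar> + b" using b by auto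
      then have "inverse (real (Suc n)) * ((a + b) / 2) \<le> inverse (real (Suc n)) * (\<bar>a\<bar> + b)"
        "inverse (real (Suc n)) * ((a - b) / 2) \<le> inverse (real (Suc n)) * (\<bar>a\<bar> + b)"
        by (auto intro!: mult_left_mono)
      moreover have "\<bar>D - c - 1/2 * a\<bar> \<le> b + R"
        if "P \<le> R" "S \<le> R" "D \<le> c + (a + b) / 2 + P" "c + (a - b) / 2 - S \<le> D" for D c P S R :: real
        using that b by (auto simp: abs_le_iff field_simps)
      ultimately show ?thesis using 1 2 by blast
    qed
    have "(\<lambda>n. b + inverse (real (Suc n)) * (\<bar>a\<bar> + b)) \<longlonglongrightarrow> b + 0 * (\<bar>a\<bar> + b)"
      by (intro tendsto_intros LIMSEQ_inverse_real_of_nat)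
    then have "\<bar>f (x + h) - f x - \<xi> \<bullet> h - 1/2 * a\<bar> \<le> b + 0 * (\<bar>a\<bar> + b)"
      by (rule LIMSEQ_le_const) (use bound in blast)
    then show ?thesis by (simp add: a_def b_def)
  qed
  then show ?thesis using d1(1) d2(1) by (intro exI[of _ "min d1 d2"]) auto
qed

text \<open>The subdifferential is monotone, so \<open>x + \<xi> \<mapsto> x\<close> is well defined and non-expansive on the set
of all \<open>x + \<xi>\<close> with \<open>\<xi>\<close> a subgradient at \<open>x\<close>. Extend it to a Lipschitz map \<open>J\<close> of the whole space.
A bad point \<open>x\<close> is the image under \<open>J\<close> of a point where \<open>J\<close> is not differentiable or has a singular
derivative; the former images are null by Rademacher's theorem, the latter by Sard's.\<close>

lemma convex_second_order_expansion_ae: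
  fixes f :: "real^'n \<Rightarrow> real"
  assumes f: "convex_on C f" and C: "open C"
  shows "negligible {x \<in> C. \<nexists>\<xi> M. linear M \<and> (\<forall>e>0. \<exists>d>0. \<forall>h. norm h < d \<longrightarrow>
    \<bar>f (x + h) - f x - \<xi> \<bullet> h - 1/2 * (M h \<bullet> h)\<bar> \<le> e * (norm h)\<^sup>2)}"
proof -
  define S where "S = {x + \<xi> | x \<xi>. x \<in> C \<and> \<xi> \<in> subdiff C f x}"
  have contr: "norm (x - y) \<le> norm (x + \<xi> - (y + \<eta>))"
    if "x \<in> C" "y \<in> C" "\<xi> \<in> subdiff C f x" "\<eta> \<in> subdiff C f y" for x y \<xi> \<eta>
  proof -
    have "norm (x - y) * norm (x - y) \<le> (x - y) \<bullet> (x - y) + (\<xi> - \<eta>) \<bullet> (x - y)"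
      using subdiff_monotone[OF that(3,4,1,2)] by (simp add: dot_square_norm power2_eq_square)
    also have "\<dots> = (x + \<xi> - (y + \<eta>)) \<bullet> (x - y)" by (simp add: inner_add_left inner_diff_left)
    also have "\<dots> \<le> norm (x + \<xi> - (y + \<eta>)) * norm (x - y)" by (rule norm_cauchy_schwarz)
    finally show ?thesis by (cases "x = y") auto
  qed
  define J0 where "J0 = (\<lambda>z. SOME x. x \<in> C \<and> z - x \<in> subdiff C f x)"
  have J0: "J0 (x + \<xi>) = x" if x: "x \<in> C" "\<xi> \<in> subdiff C f x" for x \<xi>
  proof -
    have "J0 (x + \<xi>) \<in> C \<and> x + \<xi> - J0 (x + \<xi>) \<in> subdiff C f (J0 (x + \<xi>))"
      unfolding J0_def by (rule someI[of _ x]) (use x in auto)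
    then have "norm (J0 (x + \<xi>) - x) \<le> 0"
      using contr[of "J0 (x + \<xi>)" x "x + \<xi> - J0 (x + \<xi>)" \<xi>] x by simp
    then show ?thesis by simp
  qed
  have "1-lipschitz_on S J0"
  proof (rule lipschitz_onI)
    fix y z assume "y \<in> S" "z \<in> S"
    then show "dist (J0 y) (J0 z) \<le> 1 * dist y z"
      by (auto simp: S_def J0 dist_norm intro: contr)
  qed simp
  then obtain L J where J: "L-lipschitz_on UNIV J" "\<And>z. z \<in> S \<Longrightarrow> J z = J0 z"
    using lipschitz_extension by blast
  have JS: "J (x + \<xi>) = x" if "x \<in> C" "\<xi> \<in> subdiff C f x" for x \<xi>
    using J(2)[of "x + \<xi>"] J0[OF that] that by (auto simp: S_def)
  define Z1 where "Z1 = {z. \<not> J differentiable (at z)}"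
  define Z2 where "Z2 = {z. J differentiable (at z) \<and> \<not> inj (frechet_derivative J (at z))}"
  have "negligible (J ` Z1)"
  proof (rule negligible_locally_Lipschitz_image)
    show "negligible Z1" unfolding Z1_def using J(1) by (rule rademacher)
    fix x
    show "\<exists>T B. open T \<and> x \<in> T \<and> (\<forall>y\<in>Z1 \<inter> T. norm (J y - J x) \<le> B * norm (y - x))"
      using lipschitz_onD[OF J(1)] by (intro exI[of _ UNIV] exI[of _ L]) (auto simp: dist_norm)
  qed simp
  moreover have "negligible (J ` Z2)"
    by (rule negligible_image_singular_derivative[where f' = "\<lambda>z. frechet_derivative J (at z)"])
      (auto simp: Z2_def frechet_derivative_works)
  ultimately have null: "negligible (J ` Z1 \<union> J ` Z2)" by (rule negligible_Un)
  show ?thesis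
  proof (rule negligible_subset[OF null], intro subsetI, rule ccontr)
    fix x assume x: "x \<in> {x \<in> C. \<nexists>\<xi> M. linear M \<and> (\<forall>e>0. \<exists>d>0. \<forall>h. norm h < d \<longrightarrow>
      \<bar>f (x + h) - f x - \<xi> \<bullet> h - 1/2 * (M h \<bullet> h)\<bar> \<le> e * (norm h)\<^sup>2)}"
    assume nx: "x \<notin> J ` Z1 \<union> J ` Z2"
    have "x \<in> C" using x by simp
    obtain \<xi> where \<xi>: "\<xi> \<in> subdiff C f x"
      using subdiff_nonempty[OF f C \<open>x \<in> C\<close>] by blast
    have "x + \<xi> \<notin> Z1" "x + \<xi> \<notin> Z2"
      using nx JS[OF \<open>x \<in> C\<close> \<xi>] by (metis UnI1 UnI2 imageI)+
    then have d: "(J has_derivative frechet_derivative J (at (x + \<xi>))) (at (x + \<xi>))"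
      "inj (frechet_derivative J (at (x + \<xi>)))"
      by (auto simp: Z1_def Z2_def frechet_derivative_works)
    obtain M where M: "linear M"
      "\<And>e. e > 0 \<Longrightarrow> \<exists>d>0. \<forall>y\<in>C. norm (y - x) < d \<longrightarrow>
        (\<forall>\<eta>\<in>subdiff C f y. norm (\<eta> - \<xi> - M (y - x)) \<le> e * norm (y - x))"
      using subdiff_has_derivative[OF f C \<open>x \<in> C\<close> \<xi> JS d] by blast
    show False
      using x convex_second_order_expansion[OF f C \<open>x \<in> C\<close> M] M(1) by blast
  qed
qed

text \<open>The expansion with explicit error bounds, which is easier to test along rays.\<close>

lemma has_peano_expansion_iff:
  fixes u :: "real^'n \<Rightarrow> real"
  shows "has_peano_expansion u z q B \<longleftrightarrow> B \<in> sym_matrices \<and>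
    (\<forall>e>0. \<exists>d>0. \<forall>h. norm h < d \<longrightarrow> \<bar>u (z + h) - u z - q \<bullet> h - 1/2 * ((B *v h) \<bullet> h)\<bar> \<le> e * (norm h)\<^sup>2)"
proof -
  let ?r = "\<lambda>y. u y - (u z + q \<bullet> (y - z) + 1/2 * ((B *v (y - z)) \<bullet> (y - z)))"
  have eq: "?r (z + h) = u (z + h) - u z - q \<bullet> h - 1/2 * ((B *v h) \<bullet> h)" for h by simp
  have "?r \<in> o[at z](\<lambda>y. (norm (y - z))\<^sup>2) \<longleftrightarrow>
    (\<forall>e>0. \<forall>\<^sub>F y in at z. \<bar>?r y\<bar> \<le> e * (norm (y - z))\<^sup>2)"
    by (auto simp: smallo_def)
  also have "\<dots> \<longleftrightarrow> (\<forall>e>0. \<exists>d>0. \<forall>h. norm h < d \<longrightarrow> \<bar>?r (z + h)\<bar> \<le> e * (norm h)\<^sup>2)"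
  proof (intro all_cong1 imp_cong refl)
    fix e :: real
    show "(\<forall>\<^sub>F y in at z. \<bar>?r y\<bar> \<le> e * (norm (y - z))\<^sup>2) \<longleftrightarrow>
      (\<exists>d>0. \<forall>h. norm h < d \<longrightarrow> \<bar>?r (z + h)\<bar> \<le> e * (norm h)\<^sup>2)"
    proof
      assume "\<forall>\<^sub>F y in at z. \<bar>?r y\<bar> \<le> e * (norm (y - z))\<^sup>2"
      then obtain d where d: "d > 0" "\<And>y. y \<noteq> z \<Longrightarrow> dist y z < d \<Longrightarrow> \<bar>?r y\<bar> \<le> e * (norm (y - z))\<^sup>2"
        unfolding eventually_at by blast
      have "\<bar>?r (z + h)\<bar> \<le> e * (norm h)\<^sup>2" if "norm h < d" for h
      proof (cases "h = 0")
        case False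
        then show ?thesis using d(2)[of "z + h"] that by (simp only: dist_norm add_diff_cancel_left') simp
      qed simp
      then show "\<exists>d>0. \<forall>h. norm h < d \<longrightarrow> \<bar>?r (z + h)\<bar> \<le> e * (norm h)\<^sup>2" using d(1) by blast
    next
      assume "\<exists>d>0. \<forall>h. norm h < d \<longrightarrow> \<bar>?r (z + h)\<bar> \<le> e * (norm h)\<^sup>2"
      then obtain d where d: "d > 0" "\<And>h. norm h < d \<Longrightarrow> \<bar>?r (z + h)\<bar> \<le> e * (norm h)\<^sup>2" by blast
      have "\<bar>?r y\<bar> \<le> e * (norm (y - z))\<^sup>2" if "dist y z < d" for y
        using d(2)[of "y - z"] that by (simp only: dist_norm add_diff_cancel_left' add_diff_eq)
      then show "\<forall>\<^sub>F y in at z. \<bar>?r y\<bar> \<le> e * (norm (y - z))\<^sup>2"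
        using d(1) unfolding eventually_at by blast
    qed
  qed
  finally show ?thesis unfolding has_peano_expansion_def eq by simp
qed

text \<open>Passing between \<open>u\<close> and the convex function \<open>f\<close> changes the expansion by an exact quadratic
polynomial. The quadratic form of \<open>M\<close> is the form of its symmetric part, which provides the Hessian.\<close>

theorem alexandrov:
  fixes u :: "real^'n \<Rightarrow> real"
  assumes u: "lambda_semiconvex_on lam C u" and C: "open C"
  shows "negligible {x \<in> C. \<nexists>q B. has_peano_expansion u x q B}"
proof -
  define f where "f = (\<lambda>y. u y + lam / 2 * (norm y)\<^sup>2)"
  have f: "convex_on C f"
    using u by (simp add: lambda_semiconvex_on_def f_def)
  show ?thesis
  proof (rule negligible_subset[OF convex_second_order_expansion_ae[OF f C]], rule ccontr)
    assume "\<not> {x \<in> C. \<nexists>q B. has_peano_expansion u x q B} \<subseteq> {x \<in> C. \<nexists>\<xi> M. linear M \<and> (\<forall>e>0. \<exists>d>0. \<forall>h. norm h < d \<longrightarrow>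
      \<bar>f (x + h) - f x - \<xi> \<bullet> h - 1/2 * (M h \<bullet> h)\<bar> \<le> e * (norm h)\<^sup>2)}"
    then obtain x \<xi> M where x: "\<nexists>q B. has_peano_expansion u x q B" and M: "linear M"
      and exp: "\<And>e. e > 0 \<Longrightarrow> \<exists>d>0. \<forall>h. norm h < d \<longrightarrow>
        \<bar>f (x + h) - f x - \<xi> \<bullet> h - 1/2 * (M h \<bullet> h)\<bar> \<le> e * (norm h)\<^sup>2"
      by blast
    define A where "A = matrix M"
    define B where "B = (1/2) *\<^sub>R (A + transpose A) - lam *\<^sub>R mat 1"
    have A: "A *v h = M h" for h using M by (simp add: A_def)
    have "B \<in> sym_matrices"
      by (auto simp: sym_matrices_def B_def transpose_def vec_eq_iff mat_def)
    have B: "(B *v h) \<bullet> h = M h \<bullet> h - lam * (norm h)\<^sup>2" for h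
    proof -
      have "(transpose A *v h) \<bullet> h = (A *v h) \<bullet> h"
        by (metis dot_lmul_matrix inner_commute transpose_matrix_vector)
      then show ?thesis
        by (simp add: B_def A matrix_vector_mult_diff_rdistrib matrix_vector_mult_add_rdistrib
            scaleR_matrix_vector_assoc[symmetric] inner_diff_left inner_add_left dot_square_norm)
    qed
    have "u (x + h) - u x - (\<xi> - lam *\<^sub>R x) \<bullet> h - 1/2 * ((B *v h) \<bullet> h) =
      f (x + h) - f x - \<xi> \<bullet> h - 1/2 * (M h \<bullet> h)" for h
      unfolding B f_def
      by (simp add: power2_norm_eq_inner inner_add_left inner_add_right inner_diff_left inner_commute algebra_simps)
    then have "has_peano_expansion u x (\<xi> - lam *\<^sub>R x) B"
      unfolding has_peano_expansion_iff using exp \<open>B \<in> sym_matrices\<close> by simp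
    then show False using x by blast
  qed
qed

section \<open>Upper contact and second order expansions\<close>

lemma semiconvex_midpoint:
  assumes u: "lambda_semiconvex_on lam C u" and y: "y + h \<in> C" "y - h \<in> C"
  shows "2 * u y \<le> u (y + h) + u (y - h) + lam * (norm h)\<^sup>2"
proof -
  define f where "f = (\<lambda>y. u y + lam / 2 * (norm y)\<^sup>2)"
  have "convex_on C f" using u by (simp add: lambda_semiconvex_on_def f_def)
  then have "f ((1 - 1/2) *\<^sub>R (y + h) + (1/2) *\<^sub>R (y - h)) \<le> (1 - 1/2) * f (y + h) + 1/2 * f (y - h)"
    by (rule convex_onD) (use y in auto)
  moreover have "(1 - 1/2) *\<^sub>R (y + h) + (1/2::real) *\<^sub>R (y - h) = y"
    by (simp add: vec_eq_iff field_simps)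
  ultimately have "2 * f y \<le> f (y + h) + f (y - h)" by simp
  moreover have "(norm (y + h))\<^sup>2 + (norm (y - h))\<^sup>2 = 2 * (norm y)\<^sup>2 + 2 * (norm h)\<^sup>2"
    by (simp add: power2_norm_eq_inner algebra_simps inner_commute)
  then have "lam * ((norm (y + h))\<^sup>2 + (norm (y - h))\<^sup>2) = lam * (2 * (norm y)\<^sup>2 + 2 * (norm h)\<^sup>2)"
    by simp
  ultimately show ?thesis unfolding f_def distrib_left by linarith
qed

lemma GDERIV_of_quadratic_remainder:
  fixes u :: "'a::real_inner \<Rightarrow> real"
  assumes "d > 0" and rem: "\<And>h. norm h < d \<Longrightarrow> \<bar>u (x + h) - u x - p \<bullet> h\<bar> \<le> K * (norm h)\<^sup>2"
  shows "GDERIV u x :> p"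
  unfolding gderiv_def has_derivative_at_alt
proof (intro conjI allI impI)
  show "bounded_linear (\<lambda>h. h \<bullet> p)" by (rule bounded_linear_inner_left)
  fix e :: real assume "e > 0"
  define r where "r = min d (e / (\<bar>K\<bar> + 1))"
  have r: "r > 0" "r \<le> d" "\<bar>K\<bar> * r \<le> e"
  proof -
    show "r > 0" "r \<le> d" using \<open>d > 0\<close> \<open>e > 0\<close> by (auto simp: r_def)
    have "\<bar>K\<bar> * r \<le> \<bar>K\<bar> * (e / (\<bar>K\<bar> + 1))" by (intro mult_left_mono) (auto simp: r_def)
    also have "\<dots> \<le> e" using \<open>e > 0\<close> by (simp add: field_simps)
    finally show "\<bar>K\<bar> * r \<le> e" .
  qed
  have "norm (u y - u x - (y - x) \<bullet> p) \<le> e * norm (y - x)" if y: "norm (y - x) < r" for y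
  proof -
    have "\<bar>u y - u x - p \<bullet> (y - x)\<bar> \<le> K * (norm (y - x))\<^sup>2"
      using rem[of "y - x"] y r by simp
    also have "\<dots> \<le> \<bar>K\<bar> * norm (y - x) * norm (y - x)"
      using mult_right_mono[OF abs_ge_self[of K], of "norm (y - x) * norm (y - x)"]
      by (simp add: power2_eq_square mult.assoc)
    also have "\<dots> \<le> \<bar>K\<bar> * r * norm (y - x)"
      using y by (intro mult_right_mono mult_left_mono) auto
    also have "\<dots> \<le> e * norm (y - x)" using r by (intro mult_right_mono) auto
    finally show ?thesis by (simp add: inner_commute)
  qed
  then show "\<exists>r>0. \<forall>y. norm (y - x) < r \<longrightarrow> norm (u y - u x - (y - x) \<bullet> p) \<le> e * norm (y - x)"
    using r(1) by blast
qed

lemma quadratic_form_bound: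
  fixes A :: "real^'n^'n"
  obtains K where "K > 0" "\<And>h. norm (A *v h) \<le> K * norm h" "\<And>h. \<bar>(A *v h) \<bullet> h\<bar> \<le> K * (norm h)\<^sup>2"
proof -
  obtain K where K: "K > 0" "\<And>h. norm (A *v h) \<le> K * norm h"
    using linear_bounded_pos[OF matrix_vector_mul_linear[of A]] by blast
  have "\<bar>(A *v h) \<bullet> h\<bar> \<le> K * (norm h)\<^sup>2" for h
  proof -
    have "\<bar>(A *v h) \<bullet> h\<bar> \<le> norm (A *v h) * norm h" by (rule Cauchy_Schwarz_ineq2)
    also have "\<dots> \<le> K * norm h * norm h" by (intro mult_right_mono K) auto
    finally show ?thesis by (simp add: power2_eq_square)
  qed
  then show ?thesis using that K by blast
qed

text \<open>Contact bounds \<open>u\<close> from above by a quadratic polynomial. The bound at \<open>x - h\<close> and midpoint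
semiconvexity turn into a lower bound at \<open>x + h\<close>, so \<open>u\<close> is affine up to a quadratic error.\<close>

lemma upper_contact_GDERIV:
  fixes u :: "real^'n \<Rightarrow> real"
  assumes u: "lambda_semiconvex_on lam C u" and C: "open C" "x \<in> C"
    and d: "d > 0" "\<And>h. norm h < d \<Longrightarrow> u (x + h) \<le> u x + p \<bullet> h + 1/2 * ((A *v h) \<bullet> h)"
  shows "GDERIV u x :> p"
proof -
  obtain e where e: "e > 0" "ball x e \<subseteq> C" using C openE by blast
  obtain K where K: "K > 0" "\<And>h. \<bar>(A *v h) \<bullet> h\<bar> \<le> K * (norm h)\<^sup>2"
    using quadratic_form_bound by blast
  have lam: "lam \<ge> 0" using u by (simp add: lambda_semiconvex_on_def)
  show ?thesis
  proof (rule GDERIV_of_quadratic_remainder[where d="min d e" and K="K + lam"])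
    fix h :: "real^'n" assume h: "norm h < min d e"
    have "x + h \<in> C" "x - h \<in> C" using h by (auto intro!: subsetD[OF e(2)] simp: dist_norm)
    from semiconvex_midpoint[OF u this]
    have "2 * u x \<le> u (x + h) + u (x - h) + lam * (norm h)\<^sup>2" .
    moreover have "u (x + h) \<le> u x + p \<bullet> h + 1/2 * ((A *v h) \<bullet> h)" using d(2)[of h] h by simp
    moreover have "u (x - h) \<le> u x - p \<bullet> h + 1/2 * ((A *v h) \<bullet> h)"
      using d(2)[of "- h"] h by (simp add: linear_neg[OF matrix_vector_mul_linear])
    moreover have "(A *v h) \<bullet> h \<le> K * (norm h)\<^sup>2" "0 \<le> K * (norm h)\<^sup>2" "0 \<le> lam * (norm h)\<^sup>2"
      using K(2)[of h] K(1) lam by (auto simp: abs_le_iff)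
    ultimately show "\<bar>u (x + h) - u x - p \<bullet> h\<bar> \<le> (K + lam) * (norm h)\<^sup>2"
      unfolding distrib_right abs_le_iff by (intro conjI) linarith+
  qed (use d e in simp)
qed

text \<open>This is how an error term that is small relative to \<open>t\<^sup>2\<close> gets discarded in a comparison of
quadratic forms along a ray.\<close>

lemma le_zero_of_small_quadratic:
  fixes a b :: real
  assumes "\<And>e. e > 0 \<Longrightarrow> \<exists>t>0. t * t * a \<le> e * (t * t * b)" and b: "b \<ge> 0"
  shows "a \<le> 0"
proof (rule field_le_epsilon)
  fix e :: real assume "e > 0"
  then have "e / (b + 1) > 0" using b by simp
  then obtain t where t: "t > 0" "t * t * a \<le> e / (b + 1) * (t * t * b)"
    using assms(1) by blast
  have "t * t * a \<le> t * t * (e / (b + 1) * b)" using t(2) by (simp add: mult_ac)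
  then have "a \<le> e / (b + 1) * b"
    using t(1) by (metis mult_le_cancel_left_pos mult_pos_pos)
  also have "\<dots> \<le> e" using \<open>e > 0\<close> b by (simp add: field_simps)
  finally show "a \<le> 0 + e" by simp
qed

lemma exists_small_scaleR:
  fixes v :: "'a::real_normed_vector"
  assumes "d > 0"
  shows "\<exists>t>0. norm (t *\<^sub>R v) < d"
proof (intro exI conjI)
  have n: "norm v + 1 > 0" using norm_ge_zero[of v] by linarith
  then show "d / (norm v + 1) > 0" using assms by simp
  then show "norm ((d / (norm v + 1)) *\<^sub>R v) < d"
    using n assms by (simp add: pos_divide_less_eq)
qed

lemma quadratic_scaleR:
  fixes B :: "real^'n^'n"
  shows "(B *v (t *\<^sub>R v)) \<bullet> (t *\<^sub>R v) = t * t * ((B *v v) \<bullet> v)"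
  by (simp add: matrix_vector_mult_scaleR)

lemma sym_matrices_diff: "A \<in> sym_matrices \<Longrightarrow> B \<in> sym_matrices \<Longrightarrow> A - B \<in> sym_matrices"
  by (simp add: sym_matrices_def transpose_def vec_eq_iff)

lemma upper_contact_peano:
  fixes u :: "real^'n \<Rightarrow> real"
  assumes u: "lambda_semiconvex_on lam C u" and C: "open C" "x \<in> C"
    and A: "A \<in> sym_matrices"
    and d: "d > 0" "\<And>h. norm h < d \<Longrightarrow> u (x + h) \<le> u x + p \<bullet> h + 1/2 * ((A *v h) \<bullet> h)"
    and B: "has_peano_expansion u x q B"
  shows "q = p" and "loewner_le B A"
proof -
  show qp: "q = p"
    using Du_eq[OF upper_contact_GDERIV[OF u C d]] Du_eq[OF has_peano_expansion_GDERIV[OF B]] by simp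
  have "((B - A) *v v) \<bullet> v \<le> 0" for v
  proof (rule le_zero_of_small_quadratic[where b = "2 * (norm v)\<^sup>2"])
    fix e :: real assume "e > 0"
    then obtain d' where d': "d' > 0"
      "\<And>h. norm h < d' \<Longrightarrow> \<bar>u (x + h) - u x - q \<bullet> h - 1/2 * ((B *v h) \<bullet> h)\<bar> \<le> e * (norm h)\<^sup>2"
      using B unfolding has_peano_expansion_iff by blast
    obtain t where t: "t > 0" and tv: "norm (t *\<^sub>R v) < min d d'"
      using exists_small_scaleR[of "min d d'" v] d(1) d'(1) by auto
    have "u (x + t *\<^sub>R v) \<le> u x + p \<bullet> (t *\<^sub>R v) + 1/2 * (t * t * ((A *v v) \<bullet> v))"
      using d(2)[of "t *\<^sub>R v", unfolded quadratic_scaleR] tv by simp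
    moreover have "\<bar>u (x + t *\<^sub>R v) - u x - q \<bullet> (t *\<^sub>R v) - 1/2 * (t * t * ((B *v v) \<bullet> v))\<bar> \<le> e * (t * t * (norm v)\<^sup>2)"
      using d'(2)[of "t *\<^sub>R v"] tv t by (simp only: quadratic_scaleR) (simp add: power2_eq_square mult_ac)
    ultimately have "t * t * ((B *v v) \<bullet> v) - t * t * ((A *v v) \<bullet> v) \<le> 2 * (e * (t * t * (norm v)\<^sup>2))"
      unfolding qp abs_le_iff by linarith
    then have "t * t * (((B - A) *v v) \<bullet> v) \<le> e * (t * t * (2 * (norm v)\<^sup>2))"
      by (simp add: matrix_vector_mult_diff_rdistrib inner_diff_left algebra_simps)
    then show "\<exists>t>0. t * t * (((B - A) *v v) \<bullet> v) \<le> e * (t * t * (2 * (norm v)\<^sup>2))"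
      using t by blast
  qed simp
  then show "loewner_le B A"
    using A B unfolding loewner_le_def pos_semidef_def has_peano_expansion_def
    by (auto simp: sym_matrices_diff matrix_vector_mult_diff_rdistrib inner_diff_left)
qed

lemma semiconvex_peano_lower_bound:
  fixes u :: "real^'n \<Rightarrow> real"
  assumes u: "lambda_semiconvex_on lam C u" and C: "open C" "x \<in> C"
    and B: "has_peano_expansion u x q B"
  shows "- lam * (norm v)\<^sup>2 \<le> (B *v v) \<bullet> v"
proof -
  obtain r where r: "r > 0" "ball x r \<subseteq> C" using C openE by blast
  have "- lam * (norm v)\<^sup>2 - (B *v v) \<bullet> v \<le> 0"
  proof (rule le_zero_of_small_quadratic[where b = "2 * (norm v)\<^sup>2"])
    fix e :: real assume "e > 0"
    then obtain d' where d': "d' > 0"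
      "\<And>h. norm h < d' \<Longrightarrow> \<bar>u (x + h) - u x - q \<bullet> h - 1/2 * ((B *v h) \<bullet> h)\<bar> \<le> e * (norm h)\<^sup>2"
      using B unfolding has_peano_expansion_iff by blast
    obtain t where t: "t > 0" and tv: "norm (t *\<^sub>R v) < min r d'"
      using exists_small_scaleR[of "min r d'" v] r(1) d'(1) by auto
    define h where "h = t *\<^sub>R v"
    have h: "(norm h)\<^sup>2 = t * t * (norm v)\<^sup>2" "(B *v h) \<bullet> h = t * t * ((B *v v) \<bullet> v)"
      unfolding h_def quadratic_scaleR by (auto simp: power2_eq_square)
    have "x + h \<in> C" "x - h \<in> C" using tv by (auto intro!: subsetD[OF r(2)] simp: dist_norm h_def)
    from semiconvex_midpoint[OF u this]
    have "2 * u x \<le> u (x + h) + u (x - h) + lam * (norm h)\<^sup>2" .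
    moreover have "\<bar>u (x + h) - u x - q \<bullet> h - 1/2 * ((B *v h) \<bullet> h)\<bar> \<le> e * (norm h)\<^sup>2"
      using d'(2)[of h] tv by (simp add: h_def)
    moreover have "\<bar>u (x - h) - u x + q \<bullet> h - 1/2 * ((B *v h) \<bullet> h)\<bar> \<le> e * (norm h)\<^sup>2"
      using d'(2)[of "- h"] tv by (simp add: h_def linear_neg[OF matrix_vector_mul_linear])
    ultimately have "- (lam * (norm h)\<^sup>2) - (B *v h) \<bullet> h \<le> 2 * (e * (norm h)\<^sup>2)"
      unfolding abs_le_iff by linarith
    then have "t * t * (- lam * (norm v)\<^sup>2 - (B *v v) \<bullet> v) \<le> e * (t * t * (2 * (norm v)\<^sup>2))"
      unfolding h by (simp add: algebra_simps)
    then show "\<exists>t>0. t * t * (- lam * (norm v)\<^sup>2 - (B *v v) \<bullet> v) \<le> e * (t * t * (2 * (norm v)\<^sup>2))"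
      using t by blast
  qed simp
  then show ?thesis by simp
qed

section \<open>Maxima of linear perturbations\<close>

text \<open>The lemma of Jensen and Slodkowski. Since \<open>w\<close> has a strict quadratic maximum at \<open>x\<close>, each small linear
perturbation \<open>y \<mapsto> w y - l \<bullet> y\<close> attains its maximum over the ball at a point \<open>Z l\<close> well inside. At
such points \<open>w\<close> is touched from above by an affine function and, by midpoint semiconvexity, also
bounded from below by a concave paraboloid of fixed opening. Comparing these bounds at two maximum
points shows that the slope \<open>l\<close> is a Lipschitz function of \<open>Z l\<close>. The set of maximum points is
therefore mapped by a Lipschitz map onto a ball of slopes, so it is not contained in a null set.\<close>

lemma linear_perturbation_maximum:
  fixes w :: "'a::euclidean_space \<Rightarrow> real"
  assumes r: "r > 0" and c: "c > 0" and L: "L \<ge> 0"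
    and cont: "continuous_on (cball x r) w"
    and mid: "\<And>y h. y + h \<in> cball x r \<Longrightarrow> y - h \<in> cball x r \<Longrightarrow> 2 * w y \<le> w (y + h) + w (y - h) + L * (norm h)\<^sup>2"
    and max: "\<And>y. y \<in> cball x r \<Longrightarrow> w y \<le> w x - c * (norm (y - x))\<^sup>2"
    and \<delta>: "0 < \<delta>" "\<delta> \<le> c * r / 3"
    and N: "negligible N"
  shows "\<exists>z l. z \<in> cball x (r / 3) - N \<and> norm l < \<delta> \<and> (\<forall>y\<in>cball x r. w y \<le> w z + l \<bullet> (y - z))"
proof (rule ccontr)
  assume contra: "\<not> ?thesis"
  have "\<exists>z\<in>cball x (r / 3). \<forall>y\<in>cball x r. w y \<le> w z + l \<bullet> (y - z)" if l: "l \<in> ball 0 \<delta>" for l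
  proof -
    have "\<exists>z\<in>cball x r. \<forall>y\<in>cball x r. w y - l \<bullet> y \<le> w z - l \<bullet> z"
      using r by (intro continuous_attains_sup continuous_intros cont) auto
    then obtain z where z: "z \<in> cball x r" "\<And>y. y \<in> cball x r \<Longrightarrow> w y - l \<bullet> y \<le> w z - l \<bullet> z"
      by blast
    have "w x - l \<bullet> x \<le> w z - l \<bullet> z" using z(2) r by simp
    then have "c * (norm (z - x))\<^sup>2 \<le> - l \<bullet> (z - x)"
      using max[OF z(1)] by (simp add: inner_diff_right)
    also have "\<dots> \<le> norm (- l) * norm (z - x)" by (rule norm_cauchy_schwarz)
    also have "\<dots> \<le> c * r / 3 * norm (z - x)"
      using l \<delta> by (intro mult_right_mono) auto
    finally have "norm (z - x) * (c * norm (z - x)) \<le> norm (z - x) * (c * (r / 3))"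
      by (simp add: power2_eq_square mult_ac)
    then have "norm (z - x) \<le> r / 3"
      using c r by (cases "z = x") (auto simp: mult_le_cancel_left_pos)
    then have "z \<in> cball x (r / 3)" by (simp add: dist_norm norm_minus_commute)
    moreover have "w y \<le> w z + l \<bullet> (y - z)" if "y \<in> cball x r" for y
      using z(2)[OF that] by (simp add: inner_diff_right)
    ultimately show ?thesis by blast
  qed
  then obtain Z where Z: "\<And>l. l \<in> ball 0 \<delta> \<Longrightarrow> Z l \<in> cball x (r / 3)"
    "\<And>l y. l \<in> ball 0 \<delta> \<Longrightarrow> y \<in> cball x r \<Longrightarrow> w y \<le> w (Z l) + l \<bullet> (y - Z l)"
    by metis
  have inball: "Z l + h \<in> cball x r" if "l \<in> ball 0 \<delta>" "norm h \<le> 2 * r / 3" for l h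
  proof -
    have "norm (Z l + h - x) \<le> norm (Z l - x) + norm h"
      using norm_triangle_ineq[of "Z l - x" h] by (simp add: algebra_simps)
    then show ?thesis using Z(1)[OF that(1)] that(2) by (simp add: dist_norm norm_minus_commute)
  qed
  have lower: "w (Z l) + l \<bullet> h - L * (norm h)\<^sup>2 \<le> w (Z l + h)"
    if "l \<in> ball 0 \<delta>" "norm h \<le> 2 * r / 3" for l h
  proof -
    have "Z l + h \<in> cball x r" "Z l - h \<in> cball x r"
      using inball[OF that] inball[of l "- h"] that by auto
    then show ?thesis
      using mid[of "Z l" h] Z(2)[OF that(1), of "Z l - h"] by simp
  qed
  \<comment> \<open>Steps of length \<open>s \<ge> norm (Z l - Z m)\<close> in the direction of \<open>l - m\<close>; the freedom in \<open>s\<close> covers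
    the case of coinciding maximum points.\<close>
  have gap: "norm (l - m) \<le> 2 * L * s"
    if lm: "l \<in> ball 0 \<delta>" "m \<in> ball 0 \<delta>" and s: "norm (Z l - Z m) \<le> s" "0 < s" "s \<le> 2 * r / 3" for l m s
  proof (cases "l = m")
    case True
    then show ?thesis using L s by simp
  next
    case False
    define h where "h = (s / norm (l - m)) *\<^sub>R (l - m)"
    have h: "norm h = s" "(l - m) \<bullet> h = s * norm (l - m)"
      using False s by (auto simp: h_def dot_square_norm power2_eq_square)
    have 1: "w (Z l) + l \<bullet> h - L * s\<^sup>2 \<le> w (Z l + h)"
      using lower[OF lm(1), of h] h s by simp
    have 2: "w (Z l + h) \<le> w (Z m) + m \<bullet> (Z l - Z m) + m \<bullet> h"
      using Z(2)[OF lm(2) inball[OF lm(1), of h]] h s by (simp add: inner_diff_right inner_add_right)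
    have "w (Z m) + m \<bullet> (Z l - Z m) - L * (norm (Z l - Z m))\<^sup>2 \<le> w (Z l)"
      using lower[OF lm(2), of "Z l - Z m"] s by simp
    moreover have "L * (norm (Z l - Z m))\<^sup>2 \<le> L * s\<^sup>2"
      using L s by (intro mult_left_mono power_mono) auto
    ultimately have "l \<bullet> h - m \<bullet> h \<le> 2 * L * s\<^sup>2"
      using 1 2 by linarith
    then have "s * norm (l - m) \<le> s * (2 * L * s)"
      using h(2) by (simp add: inner_diff_left power2_eq_square mult_ac)
    then show ?thesis using s by simp
  qed
  have dZ: "norm (Z l - Z m) \<le> 2 * r / 3" if "l \<in> ball 0 \<delta>" "m \<in> ball 0 \<delta>" for l m
    using Z(1)[OF that(1)] Z(1)[OF that(2)] norm_triangle_ineq4[of "Z l - x" "Z m - x"]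
    by (simp add: dist_norm norm_minus_commute)
  have inj: "l = m" if lm: "l \<in> ball 0 \<delta>" "m \<in> ball 0 \<delta>" "Z l = Z m" for l m
  proof -
    have "norm (l - m) \<le> 0"
    proof (rule field_le_epsilon)
      fix e :: real assume "e > 0"
      define s where "s = min (2 * r / 3) (e / (2 * L + 1))"
      have s: "0 < s" "s \<le> 2 * r / 3"
        using r L \<open>e > 0\<close> unfolding s_def by (simp, intro min.cobounded1)
      have "norm (l - m) \<le> 2 * L * s" using gap[OF lm(1,2) _ s] lm(3) s by simp
      also have "\<dots> \<le> 2 * L * (e / (2 * L + 1))" using L by (intro mult_left_mono) (auto simp: s_def)
      also have "\<dots> \<le> e" using L \<open>e > 0\<close> by (simp add: field_simps)
      finally show "norm (l - m) \<le> 0 + e" by simp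
    qed
    then show ?thesis by simp
  qed
  have lipZ: "norm (l - m) \<le> 2 * L * norm (Z l - Z m)" if lm: "l \<in> ball 0 \<delta>" "m \<in> ball 0 \<delta>" for l m
    using gap[OF lm order_refl _ dZ[OF lm]] inj[OF lm] by (cases "Z l = Z m") auto
  have "inj_on Z (ball 0 \<delta>)" using inj by (rule inj_onI)
  define G where "G = the_inv_into (ball 0 \<delta>) Z"
  have G: "G (Z l) = l" if "l \<in> ball 0 \<delta>" for l
    unfolding G_def using \<open>inj_on Z (ball 0 \<delta>)\<close> that by (rule the_inv_into_f_f)
  have "Z ` ball 0 \<delta> \<subseteq> N"
  proof (rule ccontr)
    assume "\<not> Z ` ball 0 \<delta> \<subseteq> N"
    then obtain l where "l \<in> ball 0 \<delta>" "Z l \<notin> N" by blast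
    then have "Z l \<in> cball x (r / 3) - N" "norm l < \<delta>" "\<forall>y\<in>cball x r. w y \<le> w (Z l) + l \<bullet> (y - Z l)"
      using Z by (auto simp del: mem_cball)
    then show False using contra by blast
  qed
  then have "negligible (Z ` ball 0 \<delta>)" using N negligible_subset by blast
  then have "negligible (G ` Z ` ball 0 \<delta>)"
  proof (rule negligible_locally_Lipschitz_image[rotated])
    fix z assume "z \<in> Z ` ball 0 \<delta>"
    then show "\<exists>T B. open T \<and> z \<in> T \<and> (\<forall>y\<in>Z ` ball 0 \<delta> \<inter> T. norm (G y - G z) \<le> B * norm (y - z))"
      by (intro exI[of _ UNIV] exI[of _ "2 * L"]) (auto simp: G lipZ simp del: mem_ball)
  qed simp
  moreover have "G ` Z ` ball 0 \<delta> = ball 0 \<delta>"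
    unfolding image_image by (simp add: G)
  ultimately show False
    using \<delta>(1) open_not_negligible[of "ball (0::'a) \<delta>"] by simp
qed

section \<open>Approximation by points of twice differentiability\<close>

lemma mat_mult_vec: "(c *\<^sub>R mat 1 :: real^'n^'n) *v h = c *\<^sub>R h"
  by (simp add: scaleR_matrix_vector_assoc[symmetric])

lemma sym_matrices_add_identity:
  assumes "A \<in> sym_matrices"
  shows "A + c *\<^sub>R mat 1 \<in> sym_matrices"
proof -
  have "A $ i $ j = A $ j $ i" for i j
    using assms by (simp add: sym_matrices_def transpose_def vec_eq_iff)
  then show ?thesis
    unfolding sym_matrices_def by (simp add: transpose_def vec_eq_iff mat_def)
qed

lemma sym_matrices_inner_commute:
  assumes "A \<in> sym_matrices"
  shows "(A *v v) \<bullet> w = (A *v w) \<bullet> v"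
proof -
  have "transpose A = A" using assms by (simp add: sym_matrices_def)
  then show ?thesis by (metis dot_lmul_matrix inner_commute transpose_matrix_vector)
qed

lemma quadratic_form_translate:
  assumes "A \<in> sym_matrices"
  shows "(A *v (a + h)) \<bullet> (a + h) = (A *v a) \<bullet> a + 2 * ((A *v a) \<bullet> h) + (A *v h) \<bullet> h"
  using sym_matrices_inner_commute[OF assms, of a h]
  by (simp add: matrix_vector_right_distrib inner_add_left inner_add_right)

text \<open>Subtracting the contact polynomial with \<open>A\<close> replaced by \<open>Q = A + \<eta> I\<close> leaves a function with a
strict quadratic maximum at \<open>x\<close>. A slightly tilted version of it has a maximum at a point \<open>z\<close> near
\<open>x\<close> that avoids the null set \<open>N\<close> and the exceptional set of Alexandrov's theorem. There
\<open>u\<close> has an upper contact jet with second component \<open>Q\<close> and first component close to \<open>p\<close>; it fixes the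
gradient and bounds the Hessian.\<close>

lemma nearby_peano_point:
  fixes u :: "real^'n \<Rightarrow> real"
  assumes u: "lambda_semiconvex_on lam C u" and C: "open C" "x \<in> C"
    and A: "A \<in> sym_matrices"
    and d: "d > 0" "\<And>h. norm h < d \<Longrightarrow> u (x + h) \<le> u x + p \<bullet> h + 1/2 * ((A *v h) \<bullet> h)"
    and N: "negligible N" and "\<eta> > 0"
  shows "\<exists>z q B. z \<in> C - N \<and> dist z x < \<eta> \<and> has_peano_expansion u z q B \<and> dist q p < \<eta> \<and>
    loewner_le B (A + \<eta> *\<^sub>R mat 1)"
proof -
  obtain e where e: "e > 0" "ball x e \<subseteq> C" using C openE by blast
  obtain K where K: "K > 0" "\<And>h. norm (A *v h) \<le> K * norm h" "\<And>h. \<bar>(A *v h) \<bullet> h\<bar> \<le> K * (norm h)\<^sup>2"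
    using quadratic_form_bound by blast
  have lam: "lam \<ge> 0" using u by (simp add: lambda_semiconvex_on_def)
  \<comment> \<open>On a ball of this radius the gradient of the contact polynomial varies by at most \<open>\<eta> / 2\<close>;
    the other half of the tolerance is left for the tilt.\<close>
  define r where "r = min (min d e / 2) (\<eta> / (2 * (K + \<eta> + 1)))"
  have "r \<le> \<eta> / (2 * (K + \<eta> + 1))" by (simp add: r_def)
  then have r\<eta>: "(K + \<eta> + 1) * r \<le> \<eta> / 2"
    using K(1) \<open>\<eta> > 0\<close> by (simp add: field_simps)
  have r: "r > 0" "r < d" "r < e" using d(1) e(1) K(1) \<open>\<eta> > 0\<close> by (auto simp: r_def)
  have Kr: "K * r > 0" "\<eta> * r > 0" using K(1) r(1) \<open>\<eta> > 0\<close> by auto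
  have rC: "cball x r \<subseteq> C" using r e(2) by auto
  define c where "c = \<eta> / 2"
  have c: "c > 0" using \<open>\<eta> > 0\<close> by (simp add: c_def)
  define Q where "Q = A + \<eta> *\<^sub>R mat 1"
  have Q: "Q \<in> sym_matrices" unfolding Q_def using A by (rule sym_matrices_add_identity)
  have Qv: "Q *v h = A *v h + \<eta> *\<^sub>R h" for h
    by (simp add: Q_def matrix_vector_mult_add_rdistrib mat_mult_vec)
  have Qq: "(Q *v h) \<bullet> h = (A *v h) \<bullet> h + \<eta> * (norm h)\<^sup>2" for h
    by (simp add: Qv inner_add_left dot_square_norm)
  define w where "w = (\<lambda>y. u y - p \<bullet> (y - x) - 1/2 * ((Q *v (y - x)) \<bullet> (y - x)))"
  define \<delta> where "\<delta> = min (c * r / 3) (\<eta> / 2)"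
  have \<delta>: "0 < \<delta>" "\<delta> \<le> c * r / 3" "\<delta> \<le> \<eta> / 2" using c r \<open>\<eta> > 0\<close> by (auto simp: \<delta>_def)
  define N' where "N' = N \<union> {z \<in> C. \<nexists>q B. has_peano_expansion u z q B}"
  have N': "negligible N'"
    unfolding N'_def using N alexandrov[OF u C(1)] by (rule negligible_Un)
  have "\<exists>z l. z \<in> cball x (r / 3) - N' \<and> norm l < \<delta> \<and> (\<forall>y\<in>cball x r. w y \<le> w z + l \<bullet> (y - z))"
  proof (rule linear_perturbation_maximum[OF r(1) c _ _ _ _ \<delta>(1,2) N'])
    show "0 \<le> lam + K + \<eta>" using lam K(1) \<open>\<eta> > 0\<close> by simp
    have "convex_on C (\<lambda>y. u y + lam / 2 * (norm y)\<^sup>2)"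
      using u by (simp add: lambda_semiconvex_on_def)
    then have "continuous_on C (\<lambda>y. u y + lam / 2 * (norm y)\<^sup>2)"
      by (rule convex_on_continuous[OF C(1)])
    then have "continuous_on C (\<lambda>y. (u y + lam / 2 * (norm y)\<^sup>2) - lam / 2 * (norm y)\<^sup>2)"
      by (rule continuous_on_diff) (intro continuous_intros)
    then have cu: "continuous_on (cball x r) u"
      using rC continuous_on_subset by fastforce
    have cQ: "continuous_on (cball x r) (\<lambda>y. Q *v (y - x))"
      by (intro linear_continuous_on_compose[OF _ matrix_vector_mul_linear] continuous_intros)
    show "continuous_on (cball x r) w"
      unfolding w_def by (intro continuous_intros cu cQ)
  next
    fix y h assume y: "y + h \<in> cball x r" "y - h \<in> cball x r"
    have "2 * u y \<le> u (y + h) + u (y - h) + lam * (norm h)\<^sup>2"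
      using y rC by (intro semiconvex_midpoint[OF u]) auto
    moreover have "(Q *v h) \<bullet> h \<le> (K + \<eta>) * (norm h)\<^sup>2"
      using K(3)[of h] by (simp add: Qq distrib_right)
    moreover have "(Q *v (y + h - x)) \<bullet> (y + h - x) = (Q *v (y - x)) \<bullet> (y - x) + 2 * ((Q *v (y - x)) \<bullet> h) + (Q *v h) \<bullet> h"
      using quadratic_form_translate[OF Q, of "y - x" h] by (simp add: algebra_simps)
    moreover have "(Q *v (y - h - x)) \<bullet> (y - h - x) = (Q *v (y - x)) \<bullet> (y - x) - 2 * ((Q *v (y - x)) \<bullet> h) + (Q *v h) \<bullet> h"
      using quadratic_form_translate[OF Q, of "y - x" "- h"]
      by (simp add: linear_neg[OF matrix_vector_mul_linear] algebra_simps)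
    moreover have "p \<bullet> (y + h - x) = p \<bullet> (y - x) + p \<bullet> h" "p \<bullet> (y - h - x) = p \<bullet> (y - x) - p \<bullet> h"
      by (simp_all add: inner_diff_right inner_add_right)
    moreover have "2 * (u0 - P0 - 1/2 * q0) \<le> (u1 - P1 - 1/2 * q1) + (u2 - P2 - 1/2 * q2) + (a + b)"
      if "2 * u0 \<le> u1 + u2 + a" "qh \<le> b" "q1 = q0 + 2 * s + qh" "q2 = q0 - 2 * s + qh" "P1 = P0 + t" "P2 = P0 - t"
      for u0 P0 q0 u1 P1 q1 u2 P2 q2 a b s t qh :: real
      using that by (simp add: field_simps)
    ultimately show "2 * w y \<le> w (y + h) + w (y - h) + (lam + K + \<eta>) * (norm h)\<^sup>2"
      unfolding w_def add.assoc[of lam] distrib_right[of lam] by blast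
  next
    fix y assume "y \<in> cball x r"
    then have "norm (y - x) < d" using r by (simp add: dist_norm norm_minus_commute)
    then have "u y \<le> u x + p \<bullet> (y - x) + 1/2 * ((A *v (y - x)) \<bullet> (y - x))"
      using d(2)[of "y - x"] by simp
    moreover have "u1 - P - 1/2 * (q + \<eta> * n) \<le> u0 - \<eta> / 2 * n" if "u1 \<le> u0 + P + 1/2 * q"
      for u1 u0 P q n :: real
      using that by (simp add: field_simps)
    moreover have "w x = u x" by (simp add: w_def)
    ultimately show "w y \<le> w x - c * (norm (y - x))\<^sup>2"
      unfolding w_def Qq c_def by simp
  qed
  then obtain z l where z: "z \<in> cball x (r / 3)" "z \<notin> N'" and l: "norm l < \<delta>"
    and contact: "\<And>y. y \<in> cball x r \<Longrightarrow> w y \<le> w z + l \<bullet> (y - z)"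
    by blast
  have zx: "norm (z - x) \<le> r / 3" using z(1) by (simp add: dist_norm norm_minus_commute)
  have "z \<in> C" using z(1) rC r(1) by (intro subsetD[OF rC]) auto
  then obtain q B where B: "has_peano_expansion u z q B" using z(2) by (auto simp: N'_def)
  \<comment> \<open>The gradient at \<open>z\<close> of the tilted contact polynomial.\<close>
  define p' where "p' = p + Q *v (z - x) + l"
  have "u (z + h) \<le> u z + p' \<bullet> h + 1/2 * ((Q *v h) \<bullet> h)" if h: "norm h < r / 3" for h
  proof -
    have "norm (z + h - x) \<le> norm (z - x) + norm h"
      using norm_triangle_ineq[of "z - x" h] by (simp add: algebra_simps)
    then have "z + h \<in> cball x r" using zx h r(1) by (simp add: dist_norm norm_minus_commute)
    then have "w (z + h) \<le> w z + l \<bullet> h" using contact[of "z + h"] by simp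
    moreover have "(Q *v (z + h - x)) \<bullet> (z + h - x) = (Q *v (z - x)) \<bullet> (z - x) + 2 * ((Q *v (z - x)) \<bullet> h) + (Q *v h) \<bullet> h"
      using quadratic_form_translate[OF Q, of "z - x" h] by (simp add: algebra_simps)
    moreover have "p \<bullet> (z + h - x) = p \<bullet> (z - x) + p \<bullet> h"
      by (simp add: inner_diff_right inner_add_right)
    ultimately show ?thesis
      unfolding w_def p'_def inner_add_left by linarith
  qed
  moreover have "r / 3 > 0" using r(1) by simp
  ultimately have q: "q = p'" "loewner_le B Q"
    using upper_contact_peano[OF u C(1) \<open>z \<in> C\<close> Q _ _ B] by blast+
  have "dist z x < \<eta>"
  proof -
    have "r \<le> (K + \<eta> + 1) * r" using Kr by (simp add: distrib_right)
    then show ?thesis using zx r(1) r\<eta> \<open>\<eta> > 0\<close> unfolding dist_norm by linarith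
  qed
  moreover have "dist q p < \<eta>"
  proof -
    have "norm (Q *v (z - x)) \<le> norm (A *v (z - x)) + norm (\<eta> *\<^sub>R (z - x))"
      unfolding Qv by (rule norm_triangle_ineq)
    also have "\<dots> \<le> (K + \<eta>) * norm (z - x)" using K(2)[of "z - x"] \<open>\<eta> > 0\<close> by (simp add: distrib_right)
    also have "\<dots> \<le> (K + \<eta>) * (r / 3)" using zx K(1) \<open>\<eta> > 0\<close> by (intro mult_left_mono) auto
    also have "\<dots> \<le> \<eta> / 2" using r\<eta> Kr r(1) by (simp add: distrib_right)
    finally have "norm (Q *v (z - x)) \<le> \<eta> / 2" .
    then have "norm (Q *v (z - x) + l) < \<eta>"
      using norm_triangle_ineq[of "Q *v (z - x)" l] l \<delta>(3) by linarith
    then show ?thesis by (simp add: q(1) p'_def dist_norm add.assoc)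
  qed
  ultimately show ?thesis
    using B q(2) \<open>z \<in> C\<close> z(2) unfolding N'_def Q_def by blast
qed

text \<open>By polarization, the entries of a symmetric matrix are controlled by its quadratic form.\<close>

lemma bounded_matrices_of_bounded_forms:
  fixes B :: "nat \<Rightarrow> real^'n^'n"
  assumes sym: "\<And>j. B j \<in> sym_matrices" and m: "\<And>j v. \<bar>(B j *v v) \<bullet> v\<bar> \<le> m * (norm v)\<^sup>2"
  shows "bounded (range B)"
proof -
  have m0: "0 \<le> m"
    using m[of 0 "axis undefined 1"] by (simp add: norm_axis_1 order_trans[OF abs_ge_zero])
  have entry: "\<bar>B j $ i $ k\<bar> \<le> 3 * m" for j i k
  proof -
    let ?v = "axis k 1 :: real^'n" and ?w = "axis i 1 :: real^'n"
    have e: "(B j *v ?v) \<bullet> ?w = B j $ i $ k"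
      by (simp add: inner_axis matrix_vector_mul_component)
    have n: "norm (?v + ?w) \<le> 2"
      using norm_triangle_ineq[of ?v ?w] by (simp add: norm_axis_1)
    have "(norm (?v + ?w))\<^sup>2 \<le> 2\<^sup>2" using n by (intro power_mono) auto
    then have "m * (norm (?v + ?w))\<^sup>2 \<le> m * 4" using m0 by (intro mult_left_mono) auto
    moreover have "(B j *v (?v + ?w)) \<bullet> (?v + ?w) = (B j *v ?v) \<bullet> ?v + 2 * B j $ i $ k + (B j *v ?w) \<bullet> ?w"
      using quadratic_form_translate[OF sym, of j ?v ?w] by (simp add: e)
    moreover have "\<bar>(B j *v ?v) \<bullet> ?v\<bar> \<le> m" "\<bar>(B j *v ?w) \<bullet> ?w\<bar> \<le> m"
      using m[of j ?v] m[of j ?w] by (simp_all add: norm_axis_1)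
    ultimately show ?thesis using m[of j "?v + ?w"] by linarith
  qed
  have "norm (B j) \<le> (\<Sum>i\<in>(UNIV::'n set). \<Sum>k\<in>(UNIV::'n set). 3 * m)" for j
  proof -
    have "norm (B j) \<le> (\<Sum>i\<in>UNIV. norm (B j $ i))"
      unfolding norm_vec_def by (rule L2_set_le_sum) auto
    also have "\<dots> \<le> (\<Sum>i\<in>UNIV. \<Sum>k\<in>UNIV. \<bar>B j $ i $ k\<bar>)"
      by (intro sum_mono norm_le_l1_cart)
    also have "\<dots> \<le> (\<Sum>i\<in>(UNIV::'n set). \<Sum>k\<in>(UNIV::'n set). 3 * m)"
      using m0 by (intro sum_mono order_trans[OF entry]) auto
    finally show ?thesis .
  qed
  then show ?thesis unfolding bounded_iff by blast
qed

lemma upper_contact_jet_at_interior: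
  fixes u :: "real^'n \<Rightarrow> real"
  assumes "upper_contact_jet X u x p A" and C: "open C" "x \<in> C" "C \<subseteq> X"
  obtains d where "d > 0" "\<And>h. norm h < d \<Longrightarrow> u (x + h) \<le> u x + p \<bullet> h + 1/2 * ((A *v h) \<bullet> h)"
proof -
  have "\<forall>\<^sub>F y in nhds x. y \<in> X"
    using C eventually_nhds by blast
  moreover have "\<forall>\<^sub>F y in nhds x. y \<in> X \<longrightarrow> u y \<le> u x + p \<bullet> (y - x) + 1/2 * ((A *v (y - x)) \<bullet> (y - x))"
    using assms(1) by (simp add: upper_contact_jet_def)
  ultimately have "\<forall>\<^sub>F y in nhds x. u y \<le> u x + p \<bullet> (y - x) + 1/2 * ((A *v (y - x)) \<bullet> (y - x))"
    by eventually_elim simp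
  then obtain d where d: "d > 0" "\<And>y. dist y x < d \<Longrightarrow> u y \<le> u x + p \<bullet> (y - x) + 1/2 * ((A *v (y - x)) \<bullet> (y - x))"
    unfolding eventually_nhds_metric by blast
  show ?thesis
  proof (rule that[OF d(1)])
    fix h :: "real^'n" assume "norm h < d"
    then show "u (x + h) \<le> u x + p \<bullet> h + 1/2 * ((A *v h) \<bullet> h)"
      using d(2)[of "x + h"] by (simp add: dist_norm)
  qed
qed

text \<open>The Hessians at the approximating points lie between \<open>- lam I\<close>, by semiconvexity, and
\<open>A + \<eta> I\<close>, so a subsequence of them converges.\<close>

lemma convergent_peano_sequence:
  fixes u :: "real^'n \<Rightarrow> real"
  assumes u: "lambda_semiconvex_on lam C u" and C: "open C" "x \<in> C"
    and A: "A \<in> sym_matrices"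
    and d: "d > 0" "\<And>h. norm h < d \<Longrightarrow> u (x + h) \<le> u x + p \<bullet> h + 1/2 * ((A *v h) \<bullet> h)"
    and N: "negligible N"
  obtains \<xi> q B Abar where "range \<xi> \<subseteq> C - N" "\<And>j::nat. has_peano_expansion u (\<xi> j) (q j) (B j)"
    "\<xi> \<longlonglongrightarrow> x" "q \<longlonglongrightarrow> p" "B \<longlonglongrightarrow> Abar" "Abar \<in> sym_matrices" "loewner_le Abar A"
proof -
  define \<eta> where "\<eta> = (\<lambda>j::nat. inverse (real (Suc j)))"
  have \<eta>: "\<eta> j > 0" "\<eta> j \<le> 1" for j by (auto simp: \<eta>_def field_simps)
  have \<eta>0: "\<eta> \<longlonglongrightarrow> 0" unfolding \<eta>_def by (rule LIMSEQ_inverse_real_of_nat)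
  have "\<forall>j. \<exists>z q B. z \<in> C - N \<and> dist z x < \<eta> j \<and> has_peano_expansion u z q B \<and> dist q p < \<eta> j \<and>
    loewner_le B (A + \<eta> j *\<^sub>R mat 1)"
    using nearby_peano_point[OF u C A d N \<eta>(1)] by blast
  then obtain \<xi> q B where \<xi>: "\<And>j. \<xi> j \<in> C - N" "\<And>j. dist (\<xi> j) x < \<eta> j"
    and P: "\<And>j. has_peano_expansion u (\<xi> j) (q j) (B j)" and q: "\<And>j. dist (q j) p < \<eta> j"
    and le: "\<And>j. loewner_le (B j) (A + \<eta> j *\<^sub>R mat 1)"
    by metis
  have \<xi>x: "\<xi> \<longlonglongrightarrow> x"
    by (rule metric_tendsto_imp_tendsto[OF \<eta>0]) (use \<xi>(2) \<eta>(1) in \<open>auto simp: dist_real_def less_imp_le intro!: always_eventually\<close>)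
  have qp: "q \<longlonglongrightarrow> p"
    by (rule metric_tendsto_imp_tendsto[OF \<eta>0]) (use q \<eta>(1) in \<open>auto simp: dist_real_def less_imp_le intro!: always_eventually\<close>)
  have symB: "B j \<in> sym_matrices" for j using P by (simp add: has_peano_expansion_def)
  have upB: "(B j *v v) \<bullet> v \<le> (A *v v) \<bullet> v + \<eta> j * (norm v)\<^sup>2" for j v
    using le[of j] unfolding loewner_le_def pos_semidef_def
    by (simp add: matrix_vector_mult_diff_rdistrib matrix_vector_mult_add_rdistrib mat_mult_vec
        inner_diff_left inner_add_left dot_square_norm)
  obtain K where K: "K > 0" "\<And>h. \<bar>(A *v h) \<bullet> h\<bar> \<le> K * (norm h)\<^sup>2"
    using quadratic_form_bound by blast
  have lam: "lam \<ge> 0" using u by (simp add: lambda_semiconvex_on_def)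
  have "bounded (range B)"
  proof (rule bounded_matrices_of_bounded_forms[OF symB, where m="lam + K + 1"])
    fix j v
    have "- lam * (norm v)\<^sup>2 \<le> (B j *v v) \<bullet> v"
      using semiconvex_peano_lower_bound[OF u C(1) _ P] \<xi>(1)[of j] by blast
    moreover have "\<eta> j * (norm v)\<^sup>2 \<le> 1 * (norm v)\<^sup>2"
      using \<eta>(2) by (intro mult_right_mono) auto
    moreover have "0 \<le> K * (norm v)\<^sup>2" "0 \<le> lam * (norm v)\<^sup>2" using K lam by auto
    ultimately show "\<bar>(B j *v v) \<bullet> v\<bar> \<le> (lam + K + 1) * (norm v)\<^sup>2"
      using upB[of j v] K(2)[of v] zero_le_power2[of "norm v"]
      unfolding distrib_right abs_le_iff mult_minus_left mult_1_left
      by (intro conjI) linarith+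
  qed
  then obtain Abar s where s: "strict_mono (s :: nat \<Rightarrow> nat)" "(B \<circ> s) \<longlonglongrightarrow> Abar"
    using bounded_imp_convergent_subsequence by blast
  have entry: "(\<lambda>j. B (s j) $ i $ k) \<longlonglongrightarrow> Abar $ i $ k" for i k
    using s(2) by (intro tendsto_vec_nth) (simp add: comp_def)
  have "Abar \<in> sym_matrices"
    unfolding sym_matrices_def transpose_def vec_eq_iff
  proof (clarsimp)
    fix i k
    have "B (s j) $ k $ i = B (s j) $ i $ k" for j
      using symB[of "s j"] by (simp add: sym_matrices_def transpose_def vec_eq_iff)
    then show "Abar $ k $ i = Abar $ i $ k"
      using entry[of i k] entry[of k i] LIMSEQ_unique by auto
  qed
  moreover have "(Abar *v v) \<bullet> v \<le> (A *v v) \<bullet> v" for v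
  proof (rule LIMSEQ_le)
    show "(\<lambda>j. (B (s j) *v v) \<bullet> v) \<longlonglongrightarrow> (Abar *v v) \<bullet> v"
      unfolding inner_vec_def matrix_vector_mult_def by (auto intro!: tendsto_intros entry)
    have "(\<lambda>j. \<eta> (s j)) \<longlonglongrightarrow> 0"
      using LIMSEQ_subseq_LIMSEQ[OF \<eta>0 s(1)] by (simp add: comp_def)
    then have "(\<lambda>j. (A *v v) \<bullet> v + \<eta> (s j) * (norm v)\<^sup>2) \<longlonglongrightarrow> (A *v v) \<bullet> v + 0 * (norm v)\<^sup>2"
      by (intro tendsto_intros)
    then show "(\<lambda>j. (A *v v) \<bullet> v + \<eta> (s j) * (norm v)\<^sup>2) \<longlonglongrightarrow> (A *v v) \<bullet> v" by simp
  qed (use upB in blast)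
  ultimately have "Abar \<in> sym_matrices" "loewner_le Abar A"
    using A unfolding loewner_le_def pos_semidef_def
    by (auto simp: sym_matrices_diff matrix_vector_mult_diff_rdistrib inner_diff_left)
  moreover have "(\<xi> \<circ> s) \<longlonglongrightarrow> x" "(q \<circ> s) \<longlonglongrightarrow> p"
    using LIMSEQ_subseq_LIMSEQ[OF _ s(1)] \<xi>x qp by auto
  ultimately show ?thesis
    using \<xi>(1) P s(2) by (intro that[of "\<xi> \<circ> s" "q \<circ> s" "B \<circ> s" Abar]) auto
qed

theorem theorem2p12:
  fixes u :: "real^'n \<Rightarrow> real" and X C :: "(real^'n) set"
    and x p :: "real^'n" and A :: "real^'n^'n"
  assumes "C \<subseteq> X" and "x \<in> interior C" and "semiconvex_on C u"
    and "upper_contact_jet X u x p A"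
  shows "u differentiable (at x) \<and> p = Du u x \<and>
      (\<forall>p' A'. upper_contact_jet X u x p' A' \<longrightarrow> p' = Du u x) \<and>
      (\<forall>E N. x \<in> interior N \<and> N - E \<in> null_sets lebesgue \<longrightarrow>
        (\<exists>(\<xi> :: nat \<Rightarrow> real^'n) Abar.
          range \<xi> \<subseteq> E \<inter> Diff2 X u \<and> \<xi> \<longlonglongrightarrow> x \<and> Abar \<in> sym_matrices \<and>
          (\<lambda>j. Du u (\<xi> j)) \<longlonglongrightarrow> Du u x \<and>
          (\<lambda>j. D2u u (\<xi> j)) \<longlonglongrightarrow> Abar \<and> loewner_le Abar A))"
proof -
  obtain lam where lam: "lambda_semiconvex_on lam C u"
    using assms(3) by (auto simp: semiconvex_on_def)
  have "convex C" using lam by (auto simp: lambda_semiconvex_on_def dest: convex_on_imp_convex)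
  have sub: "lambda_semiconvex_on lam D u" if "D \<subseteq> C" "convex D" for D
    using lam that by (auto simp: lambda_semiconvex_on_def intro: convex_on_subset)
  have intX: "interior C \<subseteq> X" using assms(1) interior_subset by blast
  have uI: "lambda_semiconvex_on lam (interior C) u"
    using \<open>convex C\<close> by (intro sub interior_subset convex_interior)
  have gd: "GDERIV u x :> p'" if jet: "upper_contact_jet X u x p' A'" for p' A'
    using upper_contact_jet_at_interior[OF jet open_interior assms(2) intX]
      upper_contact_GDERIV[OF uI open_interior assms(2)] by metis
  have p: "Du u x = p" using Du_eq[OF gd[OF assms(4)]] .
  have "u differentiable (at x)"
    using gd[OF assms(4)] unfolding gderiv_def differentiable_def by blast
  moreover have "\<forall>p' A'. upper_contact_jet X u x p' A' \<longrightarrow> p' = Du u x"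
    using Du_eq[OF gd] by metis
  moreover have "\<exists>(\<xi> :: nat \<Rightarrow> real^'n) Abar.
          range \<xi> \<subseteq> E \<inter> Diff2 X u \<and> \<xi> \<longlonglongrightarrow> x \<and> Abar \<in> sym_matrices \<and>
          (\<lambda>j. Du u (\<xi> j)) \<longlonglongrightarrow> Du u x \<and>
          (\<lambda>j. D2u u (\<xi> j)) \<longlonglongrightarrow> Abar \<and> loewner_le Abar A"
    if EN: "x \<in> interior N" "N - E \<in> null_sets lebesgue" for E N
  proof -
    obtain r where r: "r > 0" "ball x r \<subseteq> interior N" using EN(1) openE open_interior by blast
    define C' where "C' = interior C \<inter> ball x r"
    have C': "open C'" "x \<in> C'" "C' \<subseteq> interior C" "C' \<subseteq> N" "C' \<subseteq> X"
      using assms(2) r intX interior_subset by (auto simp: C'_def)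
    have uC': "lambda_semiconvex_on lam C' u"
      using C'(3) interior_subset \<open>convex C\<close> unfolding C'_def
      by (intro sub convex_Int convex_interior convex_ball) auto
    obtain d where d: "d > 0" "\<And>h. norm h < d \<Longrightarrow> u (x + h) \<le> u x + p \<bullet> h + 1/2 * ((A *v h) \<bullet> h)"
      using upper_contact_jet_at_interior[OF assms(4) C'(1,2,5)] by metis
    have "A \<in> sym_matrices" using assms(4) by (simp add: upper_contact_jet_def)
    moreover have "negligible (N - E)" using EN(2) by (simp add: negligible_iff_null_sets)
    ultimately obtain \<xi> q B Abar where \<xi>: "range \<xi> \<subseteq> C' - (N - E)"
      and P: "\<And>j::nat. has_peano_expansion u (\<xi> j) (q j) (B j)"
      and lim: "\<xi> \<longlonglongrightarrow> x" "q \<longlonglongrightarrow> p" "B \<longlonglongrightarrow> Abar" "Abar \<in> sym_matrices" "loewner_le Abar A"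
      using convergent_peano_sequence[OF uC' C'(1,2) _ d] by metis
    have "(\<lambda>j. Du u (\<xi> j)) = q" "(\<lambda>j. D2u u (\<xi> j)) = B"
      using Du_eq[OF has_peano_expansion_GDERIV[OF P]] D2u_eq[OF P] by auto
    moreover have "range \<xi> \<subseteq> E \<inter> Diff2 X u"
    proof safe
      fix j
      have "\<xi> j \<in> C'" "\<xi> j \<in> E" using \<xi> C'(4) by auto
      then show "\<xi> j \<in> E" "\<xi> j \<in> Diff2 X u"
        using P[of j] C'(3) interior_mono[OF assms(1)] by (auto simp: Diff2_def)
    qed
    ultimately show ?thesis using lim p by (intro exI[of _ \<xi>] exI[of _ Abar]) simp
  qed
  ultimately show ?thesis using p by blast
qed

end
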